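(* Consider the binary FFT model over the field $\mathbb{K}$. The recursive Algorithm F described in the context, with input $P,Q\in\mathbb{K}[x]$ such that $\deg Q<\deg P$, and $k\in2^{\mathbb{N}}$ such that $d=\deg P\geqslant2k$ and $\deg B_i(P,Q)=1$ for all $1\leqslant i\leqslant k$, and with output $B_{1;k+1}(P,Q)$ and $\mathrm{DFT}_k(B_{1;k+1}(P,Q))$, is correct and its cost is bounded by $$\tfrac43\,\mathsf{M}(k)\log_2k+O(\mathsf{M}(k)).$$
   Context: **Remainder sequences.** $\mathbb{K}$ is an effective field; $P\,\mathrm{quo}\,Q$ and $P\,\mathrm{rem}\,Q$ are quotient and remainder of Euclidean division in $\mathbb{K}[x]$. Let $P,Q\in\mathbb{K}[x]$ with $d:=\deg P>\deg Q$. Define $R_0:=P$, $R_1:=Q$, $R_{i+1}:=R_{i-1}\,\mathrm{rem}\,R_i$; the length $\ell$ is the smallest index with $R_\ell=0$. For $1\leqslant i<\ell$ let $B_i=B_i(P,Q):=\begin{pmatrix}0&1\\1&-R_{i-1}\,\mathrm{quo}\,R_i\end{pmatrix}$, regarded as a polynomial with coefficients in $\mathbb{K}^{2\times2}$. For $1\leqslant i\leqslant j\leqslant\ell$ let $B_{i;j}=B_{i;j}(P,Q):=B_{j-1}\cdots B_{i+1}B_i$ (with $B_{i;i}=\mathrm{Id}_2$). For a matrix polynomial $M$, $M_i$ is the coefficient of $x^i$ and $M_{a,b}$ the $(a,b)$ entry. **Coefficient extraction.** For $U\in\mathbb{K}[x]$, $U_{i;j}:=U_i+U_{i+1}x+\cdots+U_{j-1}x^{j-1-i}$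 (zero if $j\leqslant i$; coefficients with index out of range are zero) and $U_{i;}:=U_{i;\deg U+1}$. **Binary FFT model.** $2$ is invertible in $\mathbb{K}$, and for any polynomial $P$ occurring during computations, $\mathbb{K}$ has a primitive $n$-th root of unity $\omega_n$ with $n$ a power of two, $n>\deg P$, and $\omega_m=\omega_n^{n/m}$ whenever $m\mid n$. For a power of two $n$, $\mathrm{DFT}_n(P):=(P(\omega_n^0),\dots,P(\omega_n^{n-1}))$, entrywise for matrices (and used as evaluation also when the degree is $\geqslant n$); $\mathrm{DFT}_n^{-1}$ returns the polynomial of degree $<n$ with given values; DFTs are multiplied componentwise. FFT doubling: if $\mathrm{DFT}_{n/2}(P)$ is known, then $\mathrm{DFT}_n(P)$ is obtained from it together with the DFT of order $n/2$ of $P(\omega_nx)\,\mathrm{rem}\,(x^{n/2}-1)$. $\mathsf{F}(n)$ is the maximum cost of $\mathrm{DFT}_n$ on polynomials of degree $<n$ or of its inverse; $\mathsf{F}(n)/n$ and $\mathsf{F}(n)/(n\log n)$ are assumed non-decreasing (for $n\geqslant1$, resp. $n\geqslant2$). Cost is the number of field operations in $\mathbb{K}$. $\mathsf{M}(n)$ is the cost of multiplying two polynomials of degree $<n$; with FFT multiplication $\mathsf{M}(n)=6\,\mathsf{F}(n)+O(n)$. It is assumed that $\mathsf{M}(n)$, $\mathsf{M}(n)/n$, $\mathsf{M}(n)/(n\log n)$ are non-decreasing (for $n\geqslant0$, $n\geqslant1$, $n\geqslant2$). **Algorithm F** (input $P,Q,k$; $d:=\deg P$): 1. If $k=1$, return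 $B:=\begin{pmatrix}0&1\\1&-P_{d-2;}\,\mathrm{quo}\,Q_{d-2;}\end{pmatrix}$ and $\mathrm{DFT}_1(B)$. 2. Let $h:=k/2$. 3. Recursively compute $M:=B_{1;h+1}(P_{d-2h;},Q_{d-2h;})$ and $\mathrm{DFT}_h(M)$. Compute $\hat M=\mathrm{DFT}_k(M)$ using FFT doubling. 4. Compute $\tilde P_{d-3h;}$ and $\tilde Q_{d-3h;}$, where $\begin{pmatrix}\tilde P\\\tilde Q\end{pmatrix}=M\begin{pmatrix}P\\Q\end{pmatrix}$, as follows. Put $P_{[i]}=P_{d-4h+ih;d-3h+ih}$, $Q_{[i]}=Q_{d-4h+ih;d-3h+ih}$, $\tilde P_{[i]}=\tilde P_{d-3h+ih;d-2h+ih}$, $\tilde Q_{[i]}=\tilde Q_{d-3h+ih;d-2h+ih}$, so that $\tilde P_{d-3h;}=\tilde P_{[0]}+\tilde P_{[1]}x^h+\tilde P_{d-h}x^{2h}$ and $\tilde Q_{d-3h;}=\tilde Q_{[0]}+\tilde Q_{[1]}x^h$. Use $$\begin{pmatrix}\tilde P_{[0]}&\tilde P_{[1]}\\\tilde Q_{[0]}&\tilde Q_{[1]}\end{pmatrix}=\mathrm{DFT}_k^{-1}\left(\mathrm{DFT}_k(M)\,\mathrm{DFT}_k\begin{pmatrix}P_{[0]}+P_{[1]}x^h&P_{[1]}+P_{[2]}x^h\\Q_{[0]}+Q_{[1]}x^h&Q_{[1]}+Q_{[2]}x^h\end{pmatrix}\right)\mathrm{quo}\;x^h$$ and $\tilde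 P_{d-h}=\sum_{i=0}^h[(M_{1,1})_iP_{d-h-i}+(M_{1,2})_iQ_{d-h-i}]$. 5. Recursively compute $\tilde M:=B_{1;h+1}(\tilde P_{d-3h;},\tilde Q_{d-3h;})$ and $\mathrm{DFT}_h(\tilde M)$. Compute $\hat{\tilde M}=\mathrm{DFT}_k(\tilde M)$ using FFT doubling. 6. Compute $\hat{\tilde M}\hat M$ and $\tilde MM=\mathrm{DFT}_k^{-1}(\hat{\tilde M}\hat M)+\tilde M_hM_h(x^k-1)$. Return $\tilde MM$ and $\hat{\tilde M}\hat M$. *)

theory Defs
  imports
    "HOL-Analysis.Finite_Cartesian_Product"
    "HOL-Computational_Algebra.Polynomial"
    "HOL-Library.State_Monad"
begin

section \<open>Remainder sequences\<close>

definition mat22 :: "'b \<Rightarrow> 'b \<Rightarrow> 'b \<Rightarrow> 'b \<Rightarrow> 'b^2^2" where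
  "mat22 a b c d = (\<chi> i j. if i = 1 then (if j = 1 then a else b) else (if j = 1 then c else d))"

fun rem_seq :: "'a::field poly \<Rightarrow> 'a poly \<Rightarrow> nat \<Rightarrow> 'a poly" where
  "rem_seq P Q 0 = P"
| "rem_seq P Q (Suc 0) = Q"
| "rem_seq P Q (Suc (Suc i)) = rem_seq P Q i mod rem_seq P Q (Suc i)"

text \<open>The values of \<^const>\<open>rem_seq\<close> beyond this index are irrelevant.\<close>

definition rem_length :: "'a::field poly \<Rightarrow> 'a poly \<Rightarrow> nat" where
  "rem_length P Q = (LEAST i. rem_seq P Q i = 0)"

text \<open>Only meaningful for \<open>1 \<le> i < rem_length P Q\<close>.\<close>

definition Bmat :: "'a::field poly \<Rightarrow> 'a poly \<Rightarrow> nat \<Rightarrow> 'a poly^2^2" where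
  "Bmat P Q i = mat22 0 1 1 (- (rem_seq P Q (i - 1) div rem_seq P Q i))"

text \<open>\<open>Bprod P Q i j\<close> is the product \<open>Bmat P Q (j - 1) ** \<dots> ** Bmat P Q i\<close>.\<close>

fun Bprod :: "'a::field poly \<Rightarrow> 'a poly \<Rightarrow> nat \<Rightarrow> nat \<Rightarrow> 'a poly^2^2" where
  "Bprod P Q i 0 = mat 1"
| "Bprod P Q i (Suc j) = (if Suc j \<le> i then mat 1 else Bmat P Q j ** Bprod P Q i j)"

text \<open>A matrix of polynomials is also regarded as a polynomial with matrix coefficients;
  this is the degree of the latter.\<close>

definition matpoly_degree :: "'b::zero poly^2^2 \<Rightarrow> nat" where
  "matpoly_degree A = Max (range (\<lambda>(i, j). degree (A $ i $ j)))"

text \<open>The coefficients of index \<open>i, \<dots>, j - 1\<close>, and the polynomial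
  \<open>U\<^sub>i + U\<^sub>i\<^sub>+\<^sub>1 x + \<dots>\<close> up to the leading coefficient.\<close>

definition slice :: "'b::zero poly \<Rightarrow> nat \<Rightarrow> nat \<Rightarrow> 'b list" where
  "slice U i j = map (coeff U) [i..<j]"

definition tail :: "'b::zero poly \<Rightarrow> nat \<Rightarrow> 'b poly" where
  "tail U i = Poly (slice U i (degree U + 1))"


section \<open>Counting field operations\<close>

text \<open>The state of a computation is the number of field operations performed so far.
  Every addition, subtraction, multiplication and division counts, including
  those with a constant; moving data, reading coefficients and zero tests are free.\<close>

datatype arith = Add | Sub | Mul | Div

fun apply_arith :: "arith \<Rightarrow> 'a::field \<Rightarrow> 'a \<Rightarrow> 'a" where
  "apply_arith Add x y = x + y"
| "apply_arith Sub x y = x - y"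
| "apply_arith Mul x y = x * y"
| "apply_arith Div x y = x / y"

abbreviation return :: "'b \<Rightarrow> (nat, 'b) state" where
  "return \<equiv> State_Monad.return"

definition arith_op :: "arith \<Rightarrow> 'a::field \<Rightarrow> 'a \<Rightarrow> (nat, 'a) state" where
  "arith_op f x y = do {
     c \<leftarrow> State_Monad.get;
     State_Monad.set (Suc c);
     return (apply_arith f x y)
   }"

definition result :: "(nat, 'b) state \<Rightarrow> 'b" where
  "result m = fst (run_state m 0)"

definition cost :: "(nat, 'b) state \<Rightarrow> nat" where
  "cost m = snd (run_state m 0)"

text \<open>Arithmetic programs (algebraic computation trees), used for the DFTs, the inverse DFTs
  and the multiplications, whose algorithms are not specified. \<open>Var i\<close> refers to the \<open>i\<close>-th
  input, or, beyond the inputs, to the results of the preceding operations in order.\<close>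

datatype 'a operand = Var nat | Const 'a

datatype 'a prog =
    Output "'a operand list"
  | Compute arith "'a operand" "'a operand" "'a prog"
  | If_Zero "'a operand" "'a prog" "'a prog"

fun operand_val :: "'a::field list \<Rightarrow> 'a operand \<Rightarrow> 'a" where
  "operand_val env (Var i) = (if i < length env then env ! i else 0)"
| "operand_val env (Const c) = c"

primrec run_prog :: "'a::field prog \<Rightarrow> 'a list \<Rightarrow> (nat, 'a list) state" where
  "run_prog (Output vs) env = return (map (operand_val env) vs)"
| "run_prog (Compute f u v p) env = do {
     z \<leftarrow> arith_op f (operand_val env u) (operand_val env v);
     run_prog p (env @ [z])
   }"
| "run_prog (If_Zero v p q) env =
     (if operand_val env v = 0 then run_prog p env else run_prog q env)"


section \<open>The binary FFT model\<close>

definition primitive_root_of_unity :: "nat \<Rightarrow> 'a::field \<Rightarrow> bool" where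
  "primitive_root_of_unity n w \<longleftrightarrow>
     0 < n \<and> w ^ n = 1 \<and> (\<forall>m. 0 < m \<and> m < n \<longrightarrow> w ^ m \<noteq> 1)"

definition DFT :: "(nat \<Rightarrow> 'a::field) \<Rightarrow> nat \<Rightarrow> 'a poly \<Rightarrow> 'a list" where
  "DFT \<omega> n U = map (\<lambda>i. poly U (\<omega> n ^ i)) [0..<n]"

definition DFT_mat :: "(nat \<Rightarrow> 'a::field) \<Rightarrow> nat \<Rightarrow> 'a poly^2^2 \<Rightarrow> 'a list^2^2" where
  "DFT_mat \<omega> n A = (\<chi> i j. DFT \<omega> n (A $ i $ j))"

text \<open>The set \<open>orders\<close> consists of the powers of two \<open>n\<close> for which the field provides \<open>\<omega> n\<close>.
  If it has roots of unity of all such orders, then this is the set of all powers of two; over a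
  finite field, it is finite.

  The programs \<open>dft n\<close>, \<open>idft n\<close> and \<open>mult n\<close> are arbitrary correct ones. The functions \<open>F\<close> and
  \<open>M\<close> are only required to bound the worst-case costs, which covers the case of equality.
  Indeed, monotonicity of \<open>M n / (n * log n)\<close> at all \<open>n\<close> is too restrictive for an exact
  (hence integer) cost that is quasi-linear.\<close>

locale binary_fft_model =
  fixes orders :: "nat set"
    and \<omega> :: "nat \<Rightarrow> 'a::field"
    and dft idft mult :: "nat \<Rightarrow> 'a prog"
    and F M :: "nat \<Rightarrow> real"
  assumes two_invertible: "(2 :: 'a) \<noteq> 0"
    and orders_power_of_two: "n \<in> orders \<Longrightarrow> \<exists>j. n = 2 ^ j"
    and orders_dvd: "n \<in> orders \<Longrightarrow> m dvd n \<Longrightarrow> m \<in> orders"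
    and \<omega>_primitive: "n \<in> orders \<Longrightarrow> primitive_root_of_unity n (\<omega> n)"
    and \<omega>_compatible: "n \<in> orders \<Longrightarrow> m dvd n \<Longrightarrow> \<omega> m = \<omega> n ^ (n div m)"
    and dft_correct: "n \<in> orders \<Longrightarrow> length us = n \<Longrightarrow>
          result (run_prog (dft n) us) = DFT \<omega> n (Poly us)"
    and dft_cost: "n \<in> orders \<Longrightarrow> length us = n \<Longrightarrow> real (cost (run_prog (dft n) us)) \<le> F n"
    and idft_correct: "n \<in> orders \<Longrightarrow> length vs = n \<Longrightarrow>
          length (result (run_prog (idft n) vs)) = n \<and>
          DFT \<omega> n (Poly (result (run_prog (idft n) vs))) = vs"
    and idft_cost: "n \<in> orders \<Longrightarrow> length vs = n \<Longrightarrow> real (cost (run_prog (idft n) vs)) \<le> F n"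
    and F_mono1: "m \<in> orders \<Longrightarrow> n \<in> orders \<Longrightarrow> 1 \<le> m \<Longrightarrow> m \<le> n \<Longrightarrow> F m / m \<le> F n / n"
    and F_mono2: "m \<in> orders \<Longrightarrow> n \<in> orders \<Longrightarrow> 2 \<le> m \<Longrightarrow> m \<le> n \<Longrightarrow>
          F m / (m * log 2 m) \<le> F n / (n * log 2 n)"
    and mult_correct: "length us = n \<Longrightarrow> length vs = n \<Longrightarrow>
          result (run_prog (mult n) (us @ vs)) = slice (Poly us * Poly vs) 0 (2 * n - 1)"
    and mult_cost: "length us = n \<Longrightarrow> length vs = n \<Longrightarrow>
          real (cost (run_prog (mult n) (us @ vs))) \<le> M n"
    and M_mono0: "m \<le> n \<Longrightarrow> M m \<le> M n"
    and M_mono1: "1 \<le> m \<Longrightarrow> m \<le> n \<Longrightarrow> M m / m \<le> M n / n"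
    and M_mono2: "2 \<le> m \<Longrightarrow> m \<le> n \<Longrightarrow> M m / (m * log 2 m) \<le> M n / (n * log 2 n)"
    and M_F: "\<exists>c. \<forall>n\<in>orders. \<bar>M n - 6 * F n\<bar> \<le> c * real n"


section \<open>Elementary counted computations\<close>

definition build_mat :: "(2 \<Rightarrow> 2 \<Rightarrow> (nat, 'b) state) \<Rightarrow> (nat, 'b^2^2) state" where
  "build_mat f = do {
     a \<leftarrow> f 1 1;
     b \<leftarrow> f 1 2;
     c \<leftarrow> f 2 1;
     d \<leftarrow> f 2 2;
     return (mat22 a b c d)
   }"

fun zip_op :: "arith \<Rightarrow> 'a::field list \<Rightarrow> 'a list \<Rightarrow> (nat, 'a list) state" where
  "zip_op f (x # xs) (y # ys) = do {
     z \<leftarrow> arith_op f x y;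
     zs \<leftarrow> zip_op f xs ys;
     return (z # zs)
   }"
| "zip_op f _ _ = return []"

primrec sum_op :: "'a::field list \<Rightarrow> (nat, 'a) state" where
  "sum_op [] = return 0"
| "sum_op (x # xs) = do {
     s \<leftarrow> sum_op xs;
     arith_op Add x s
   }"

text \<open>Product of \<open>2 \<times> 2\<close> matrices whose entries are vectors, multiplied componentwise.\<close>

definition mat_mult_op ::
  "'a::field list^2^2 \<Rightarrow> 'a list^2^2 \<Rightarrow> (nat, 'a list^2^2) state" where
  "mat_mult_op A B = build_mat (\<lambda>i j. do {
     us \<leftarrow> zip_op Mul (A $ i $ 1) (B $ 1 $ j);
     vs \<leftarrow> zip_op Mul (A $ i $ 2) (B $ 2 $ j);
     zip_op Add us vs
   })"

text \<open>The list \<open>[1, w, \<dots>, w ^ n]\<close>.\<close>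

primrec powers_op :: "'a::field \<Rightarrow> nat \<Rightarrow> (nat, 'a list) state" where
  "powers_op w 0 = return [1]"
| "powers_op w (Suc n) = do {
     ws \<leftarrow> powers_op w n;
     z \<leftarrow> arith_op Mul (last ws) w;
     return (ws @ [z])
   }"

text \<open>FFT doubling for \<open>degree U \<le> h\<close> with \<open>n = 2 * h\<close>: given \<open>vs = DFT \<omega> h U\<close>, compute the DFT
  of order \<open>h\<close> of \<open>U (\<omega>\<^sub>n x) rem (x ^ h - 1)\<close>, which yields the values at the odd powers of
  \<open>\<omega>\<^sub>n\<close>. The remainder folds the coefficient of \<open>x ^ h\<close> onto the constant one.\<close>

definition fft_double ::
  "(nat \<Rightarrow> 'a::field) \<Rightarrow> (nat \<Rightarrow> 'a prog) \<Rightarrow> nat \<Rightarrow> 'a poly \<Rightarrow> 'a list \<Rightarrow> (nat, 'a list) state" where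
  "fft_double \<omega> dft n U vs = (let h = n div 2 in do {
     ws \<leftarrow> powers_op (\<omega> n) h;
     us \<leftarrow> zip_op Mul (slice U 0 (h + 1)) ws;
     u0 \<leftarrow> arith_op Add (us ! 0) (us ! h);
     odds \<leftarrow> run_prog (dft h) (u0 # tl (take h us));
     return (splice vs odds)
   })"


section \<open>The recursive half-gcd algorithm\<close>

text \<open>Schoolbook division of \<open>a2 x\<^sup>2 + a1 x + \<dots>\<close> by \<open>b1 x + b0\<close>; the case \<open>k = 1\<close>.\<close>

definition algorithm_F_base ::
  "'a::field poly \<Rightarrow> 'a poly \<Rightarrow> (nat, ('a poly^2^2) \<times> ('a list^2^2)) state" where
  "algorithm_F_base P Q = (let d = degree P; P' = tail P (d - 2); Q' = tail Q (d - 2) in do {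
     q1 \<leftarrow> arith_op Div (coeff P' 2) (coeff Q' 1);
     t \<leftarrow> arith_op Mul q1 (coeff Q' 0);
     r \<leftarrow> arith_op Sub (coeff P' 1) t;
     q0 \<leftarrow> arith_op Div r (coeff Q' 1);
     n1 \<leftarrow> arith_op Sub 0 q1;
     n0 \<leftarrow> arith_op Sub 0 q0;
     v \<leftarrow> arith_op Add n0 n1;
     return (mat22 0 1 1 [:n0, n1:], mat22 [0] [1] [1] [v])
   })"

text \<open>From \<open>A = B\<^sub>1\<^sub>;\<^sub>h\<^sub>+\<^sub>1\<close>, compute the coefficients of index at least \<open>d - 3 * h\<close> in \<open>A (P, Q)\<^sup>T\<close>.
  In a cyclic product of order \<open>2 * h\<close>, only the lower \<open>h\<close> coefficients are affected by wrap-around.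
  The indices do not underflow when \<open>4 * h \<le> degree P\<close>; \<open>drop h\<close> is the quotient by
  \<open>x ^ h\<close>.\<close>

definition algorithm_F_update ::
  "(nat \<Rightarrow> 'a::field prog) \<Rightarrow> (nat \<Rightarrow> 'a prog) \<Rightarrow> nat \<Rightarrow> 'a poly^2^2 \<Rightarrow> 'a list^2^2 \<Rightarrow>
   'a poly \<Rightarrow> 'a poly \<Rightarrow> (nat, 'a poly \<times> 'a poly) state" where
  "algorithm_F_update dft idft k A A_hat P Q = (let
     d = degree P;
     h = k div 2;
     block = (\<lambda>U i. slice U (d - 4 * h + i * h) (d - 3 * h + i * h));
     X = mat22 (block P 0 @ block P 1) (block P 1 @ block P 2)
               (block Q 0 @ block Q 1) (block Q 1 @ block Q 2)
   in do {
     X_hat \<leftarrow> build_mat (\<lambda>i j. run_prog (dft k) (X $ i $ j));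
     Y_hat \<leftarrow> mat_mult_op A_hat X_hat;
     Y \<leftarrow> build_mat (\<lambda>i j. run_prog (idft k) (Y_hat $ i $ j));
     us \<leftarrow> zip_op Mul (slice (A $ 1 $ 1) 0 (h + 1)) (map (\<lambda>i. coeff P (d - h - i)) [0..<h + 1]);
     vs \<leftarrow> zip_op Mul (slice (A $ 1 $ 2) 0 (h + 1)) (map (\<lambda>i. coeff Q (d - h - i)) [0..<h + 1]);
     top_coeff \<leftarrow> sum_op (us @ vs);
     return (Poly (drop h (Y $ 1 $ 1) @ drop h (Y $ 1 $ 2) @ [top_coeff]),
             Poly (drop h (Y $ 2 $ 1) @ drop h (Y $ 2 $ 2)))
   })"

text \<open>Here \<open>C = A'\<^sub>h A\<^sub>h\<close>, and \<open>C (x ^ k - 1)\<close> corrects the cyclic product.\<close>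

definition algorithm_F_combine ::
  "(nat \<Rightarrow> 'a::field prog) \<Rightarrow> nat \<Rightarrow> 'a poly^2^2 \<Rightarrow> 'a list^2^2 \<Rightarrow> 'a poly^2^2 \<Rightarrow> 'a list^2^2 \<Rightarrow>
   (nat, ('a poly^2^2) \<times> ('a list^2^2)) state" where
  "algorithm_F_combine idft k A A_hat A' A'_hat = (let h = k div 2 in do {
     V \<leftarrow> mat_mult_op A'_hat A_hat;
     Z \<leftarrow> build_mat (\<lambda>i j. run_prog (idft k) (V $ i $ j));
     C \<leftarrow> build_mat (\<lambda>i j. do {
       u \<leftarrow> arith_op Mul (coeff (A' $ i $ 1) h) (coeff (A $ 1 $ j) h);
       v \<leftarrow> arith_op Mul (coeff (A' $ i $ 2) h) (coeff (A $ 2 $ j) h);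
       arith_op Add u v
     });
     N \<leftarrow> build_mat (\<lambda>i j. do {
       z0 \<leftarrow> arith_op Sub ((Z $ i $ j) ! 0) (C $ i $ j);
       return (Poly (z0 # tl (Z $ i $ j) @ [C $ i $ j]))
     });
     return (N, V)
   })"

text \<open>The algorithm is only meant for powers of two; the case \<open>k = 0\<close> is irrelevant.\<close>

fun algorithm_F ::
  "(nat \<Rightarrow> 'a::field) \<Rightarrow> (nat \<Rightarrow> 'a prog) \<Rightarrow> (nat \<Rightarrow> 'a prog) \<Rightarrow> 'a poly \<Rightarrow> 'a poly \<Rightarrow> nat \<Rightarrow>
   (nat, ('a poly^2^2) \<times> ('a list^2^2)) state" where
  "algorithm_F \<omega> dft idft P Q k =
     (if k \<le> 1 then algorithm_F_base P Q
      else let h = k div 2; d = degree P in do {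
        (A, A_h) \<leftarrow> algorithm_F \<omega> dft idft (tail P (d - 2 * h)) (tail Q (d - 2 * h)) h;
        A_hat \<leftarrow> build_mat (\<lambda>i j. fft_double \<omega> dft k (A $ i $ j) (A_h $ i $ j));
        (P', Q') \<leftarrow> algorithm_F_update dft idft k A A_hat P Q;
        (A', A'_h) \<leftarrow> algorithm_F \<omega> dft idft P' Q' h;
        A'_hat \<leftarrow> build_mat (\<lambda>i j. fft_double \<omega> dft k (A' $ i $ j) (A'_h $ i $ j));
        algorithm_F_combine idft k A A_hat A' A'_hat
      })"

declare algorithm_F.simps [simp del]

text \<open>The algorithm assumes that the quotients \<open>R\<^sub>i\<^sub>-\<^sub>1 quo R\<^sub>i\<close> exist and have degree one for
  \<open>1 \<le> i \<le> k\<close>; the first condition is implicit in the use of \<open>B\<^sub>i\<close>.\<close>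

definition valid_input :: "'a::field poly \<Rightarrow> 'a poly \<Rightarrow> nat \<Rightarrow> bool" where
  "valid_input P Q k \<longleftrightarrow>
     degree Q < degree P \<and> 2 * k \<le> degree P \<and>
     k < rem_length P Q \<and> (\<forall>i\<in>{1..k}. matpoly_degree (Bmat P Q i) = 1)"

end

theory Submission
  imports Defs "HOL-Analysis.Cartesian_Space"
begin

text \<open>Correctness rests on two facts. When all quotients are linear, the first \<open>h\<close> of them depend only on
  the coefficients of index at least \<open>d - 2 * h\<close>: the error of the truncated remainder sequence
  (shifted back) grows by one degree per step while the remainders shrink by one. And in the cyclic
  products of order \<open>2 * h\<close>, the wrapped coefficients are either discarded or known in advance.

  One level of the recursion uses twelve transforms of order \<open>k\<close> and eight of order \<open>k div 2\<close>, hence at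
  most \<open>16 * F k + O(k)\<close>, that is \<open>8 / 3 * M k + O(k)\<close>, operations. Monotonicity of
  \<open>M k / (k * log k)\<close> makes the levels decay linearly, so that their sum is half of \<open>log k\<close> times
  the top one. The terms \<open>O(k * log k)\<close> are absorbed by \<open>M k\<close> because one multiplication in
  a field with \<open>2 \<noteq> 0\<close> cannot be free: \<open>M 1 \<ge> 1\<close>.\<close>

section \<open>Counted computations\<close>

text \<open>Asking for one count \<open>n\<close> that serves every initial counter makes bounds add
  up along binds. The bound is real because \<open>F\<close> and \<open>M\<close> are.\<close>

definition computes :: "(nat, 'b) state \<Rightarrow> 'b \<Rightarrow> real \<Rightarrow> bool" where
  "computes m r b \<longleftrightarrow> (\<exists>n. (\<forall>c. run_state m c = (r, c + n)) \<and> real n \<le> b)"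

lemma computes_result: "computes m r b \<Longrightarrow> result m = r"
  by (auto simp: computes_def result_def)

lemma computes_cost: "computes m r b \<Longrightarrow> real (cost m) \<le> b"
  by (auto simp: computes_def cost_def)

lemma computes_mono: "computes m r b \<Longrightarrow> b \<le> b' \<Longrightarrow> computes m r b'"
  by (auto simp: computes_def intro: order_trans)

lemma computes_return: "computes (return x) x 0"
  by (auto simp: computes_def)

lemma computes_bind:
  assumes "computes m r b" "computes (f r) s b'"
  shows "computes (State_Monad.bind m f) s (b + b')"
proof -
  obtain n where n: "\<And>c. run_state m c = (r, c + n)" "real n \<le> b"
    using assms(1) by (auto simp: computes_def)
  obtain n' where n': "\<And>c. run_state (f r) c = (s, c + n')" "real n' \<le> b'"
    using assms(2) by (auto simp: computes_def)
  show ?thesis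
    unfolding computes_def by (rule exI[of _ "n + n'"]) (use n n' in auto)
qed

lemma computes_arith: "computes (arith_op f x y) (apply_arith f x y) 1"
  by (auto simp: computes_def arith_op_def State_Monad.get_def State_Monad.set_def)

text \<open>On fixed inputs the number of operations does not depend on the counter, so the
  unspecified transforms enter with their actual results and costs.\<close>

lemma computes_run_prog:
  "computes (run_prog p env) (result (run_prog p env)) (real (cost (run_prog p env)))"
proof -
  have "\<exists>r b. computes (run_prog p env) r b"
  proof (induction p arbitrary: env)
    case (Output vs)
    show ?case unfolding run_prog.simps by (intro exI) (rule computes_return)
  next
    case (Compute f u v p)
    obtain r b where "computes (run_prog p (env @
        [apply_arith f (operand_val env u) (operand_val env v)])) r b"
      using Compute by blast
    then have "computes (run_prog (Compute f u v p) env) r (1 + b)"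
      unfolding run_prog.simps by (rule computes_bind[OF computes_arith])
    then show ?case by blast
  next
    case (If_Zero v p q)
    then show ?case by auto
  qed
  then show ?thesis by (auto simp: computes_def result_def cost_def)
qed

lemma computes_zip_op:
  "length xs = length ys \<Longrightarrow>
    computes (zip_op f xs ys) (map2 (apply_arith f) xs ys) (real (length xs))"
proof (induction xs ys rule: list_induct2)
  case Nil
  then show ?case by (simp add: computes_return)
next
  case (Cons x xs y ys)
  \<comment> \<open>One summand per bind, nested as \<open>computes_bind\<close> produces them;
    \<open>computes_mono\<close> collects them afterwards. Later counts follow the same
    pattern.\<close>
  have "computes (zip_op f (x # xs) (y # ys))
     (map2 (apply_arith f) (x # xs) (y # ys)) (1 + (real (length xs) + 0))"
    unfolding zip_op.simps list.map zip_Cons_Cons prod.case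
    by (rule computes_bind computes_arith computes_return Cons.IH)+
  then show ?case by (rule computes_mono) simp
qed

lemma computes_sum_op: "computes (sum_op xs) (sum_list xs) (real (length xs))"
proof (induction xs)
  case Nil
  then show ?case by (simp add: computes_return)
next
  case (Cons x xs)
  have "computes (sum_op (x # xs)) (apply_arith Add x (sum_list xs)) (real (length xs) + 1)"
    unfolding sum_op.simps by (rule computes_bind computes_arith Cons)+
  then show ?case by (auto intro: computes_mono)
qed

lemma computes_powers_op: "computes (powers_op w n) (map (\<lambda>i. w ^ i) [0..<Suc n]) (real n)"
proof (induction n)
  case 0
  then show ?case by (simp add: computes_return)
next
  case (Suc n)
  have "computes (powers_op w (Suc n))
     (map (\<lambda>i. w ^ i) [0..<Suc n] @ [apply_arith Mul (last (map (\<lambda>i. w ^ i) [0..<Suc n])) w])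
     (real n + (1 + 0))"
    unfolding powers_op.simps by (rule computes_bind computes_arith computes_return Suc)+
  then show ?case by (auto intro: computes_mono simp: mult.commute)
qed

section \<open>Two by two matrices and their transforms\<close>

lemma mat22_nth [simp]:
  "mat22 a b c d $ 1 $ 1 = a" "mat22 a b c d $ 1 $ 2 = b"
  "mat22 a b c d $ 2 $ 1 = c" "mat22 a b c d $ 2 $ 2 = d"
  by (simp_all add: mat22_def)

lemma mat22_eq_iff:
  "mat22 a b c d = A \<longleftrightarrow> a = A $ 1 $ 1 \<and> b = A $ 1 $ 2 \<and> c = A $ 2 $ 1 \<and> d = A $ 2 $ 2"
  by (auto simp: vec_eq_iff forall_2)

lemma computes_build_mat:
  assumes "\<And>i j. computes (f i j) (A $ i $ j) b"
  shows "computes (build_mat f) A (4 * b)"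
proof -
  have "computes (build_mat f) (mat22 (A $ 1 $ 1) (A $ 1 $ 2) (A $ 2 $ 1) (A $ 2 $ 2))
      (b + (b + (b + (b + 0))))"
    unfolding build_mat_def by (rule computes_bind computes_return assms)+
  moreover have "mat22 (A $ 1 $ 1) (A $ 1 $ 2) (A $ 2 $ 1) (A $ 2 $ 2) = A"
    by (simp add: mat22_eq_iff)
  ultimately show ?thesis by (auto intro: computes_mono)
qed

lemma matrix_mult_2_nth:
  fixes A B :: "'a::semiring_1^2^2"
  shows "(A ** B) $ i $ j = A $ i $ 1 * B $ 1 $ j + A $ i $ 2 * B $ 2 $ j"
  by (simp add: matrix_matrix_mult_def sum_2)

lemma length_DFT [simp]: "length (DFT \<omega> n U) = n"
  by (simp add: DFT_def)

lemma DFT_mat_nth [simp]: "DFT_mat \<omega> n A $ i $ j = DFT \<omega> n (A $ i $ j)"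
  by (simp add: DFT_mat_def)

text \<open>Evaluation at a point is a ring homomorphism, so this holds for all degrees. Each of the
  four entries takes two products and one sum of vectors of length \<open>n\<close>.\<close>

lemma computes_mat_mult_op:
  "computes (mat_mult_op (DFT_mat \<omega> n A) (DFT_mat \<omega> n B)) (DFT_mat \<omega> n (A ** B)) (12 * real n)"
proof -
  let ?C = "\<lambda>i j l. map2 (apply_arith Mul) (DFT \<omega> n (A $ i $ l)) (DFT \<omega> n (B $ l $ j))"
  let ?S = "\<lambda>i j. map2 (apply_arith Add) (?C i j 1) (?C i j 2)"
  have S: "?S i j = DFT_mat \<omega> n (A ** B) $ i $ j" for i j
    by (rule nth_equalityI) (simp_all add: DFT_def matrix_mult_2_nth)
  have "computes (do {
     us \<leftarrow> zip_op Mul (DFT_mat \<omega> n A $ i $ 1) (DFT_mat \<omega> n B $ 1 $ j);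
     vs \<leftarrow> zip_op Mul (DFT_mat \<omega> n A $ i $ 2) (DFT_mat \<omega> n B $ 2 $ j);
     zip_op Add us vs
   }) (?S i j) (real n + (real n + real n))" for i j
    using computes_zip_op[of "DFT \<omega> n (A $ i $ 1)" "DFT \<omega> n (B $ 1 $ j)" Mul]
      computes_zip_op[of "DFT \<omega> n (A $ i $ 2)" "DFT \<omega> n (B $ 2 $ j)" Mul]
      computes_zip_op[of "?C i j 1" "?C i j 2" Add]
    by (intro computes_bind) simp_all
  then have "computes (mat_mult_op (DFT_mat \<omega> n A) (DFT_mat \<omega> n B)) (DFT_mat \<omega> n (A ** B))
      (4 * (real n + (real n + real n)))"
    unfolding mat_mult_op_def S by (intro computes_build_mat) auto
  then show ?thesis by (auto intro: computes_mono)
qed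

section \<open>Truncated remainder sequences\<close>

lemma length_slice [simp]: "length (slice U i j) = j - i"
  by (simp add: slice_def)

lemma slice_nth [simp]: "m < j - i \<Longrightarrow> slice U i j ! m = coeff U (i + m)"
  by (simp add: slice_def)

lemma tail_eq_poly_shift: "tail U i = poly_shift i U"
  by (rule poly_eqI)
    (auto simp: tail_def coeff_poly_shift nth_default_def add.commute coeff_eq_0)

lemma coeff_tail [simp]: "coeff (tail U i) m = coeff U (i + m)"
  by (simp add: tail_eq_poly_shift coeff_poly_shift add.commute)

lemma degree_tail: "i \<le> degree U \<Longrightarrow> degree (tail U i) = degree U - i"
proof (cases "U = 0")
  case False
  assume "i \<le> degree U"
  with False show ?thesis
    by (intro antisym degree_le le_degree allI impI) (auto intro: coeff_eq_0)
qed (simp add: tail_eq_poly_shift)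

text \<open>Degree less than \<open>n\<close> in the sense that gives the zero polynomial degree \<open>-\<infinity>\<close>.\<close>

definition deg_below :: "nat \<Rightarrow> 'a::comm_ring_1 poly \<Rightarrow> bool" where
  "deg_below n U \<longleftrightarrow> (\<forall>m\<ge>n. coeff U m = 0)"

lemma deg_below_mono: "deg_below m U \<Longrightarrow> m \<le> n \<Longrightarrow> deg_below n U"
  by (auto simp: deg_below_def)

lemma deg_below_diff: "deg_below n U \<Longrightarrow> deg_below n V \<Longrightarrow> deg_below n (U - V)"
  by (auto simp: deg_below_def)

lemma deg_below_mult:
  assumes "deg_below n U" "degree V \<le> r"
  shows "deg_below (r + n) (V * U)"
  unfolding deg_below_def
proof (intro allI impI)
  fix m assume m: "r + n \<le> m"
  have "coeff V i * coeff U (m - i) = 0" for i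
    using assms m by (cases "i \<le> r") (auto simp: deg_below_def coeff_eq_0)
  then show "coeff (V * U) m = 0" by (simp add: coeff_mult)
qed

text \<open>For \<open>1 \<le> k\<close>, the second condition says that the first \<open>k\<close> quotients exist and are linear.\<close>

definition normal_rem_seq :: "'a::field poly \<Rightarrow> 'a poly \<Rightarrow> nat \<Rightarrow> bool" where
  "normal_rem_seq P Q k \<longleftrightarrow> 2 * k \<le> degree P \<and> (\<forall>i\<le>k. degree (rem_seq P Q i) + i = degree P)"

lemma matpoly_degree_mat22:
  "matpoly_degree (mat22 a b c d) = max (max (degree a) (degree b)) (max (degree c) (degree d))"
proof -
  have "range (\<lambda>(i, j). degree (mat22 a b c d $ i $ j)) =
      {degree a, degree b, degree c, degree d}"
    by (auto simp: UNIV_2 simp flip: UNIV_Times_UNIV)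
  then show ?thesis by (simp add: matpoly_degree_def max.assoc)
qed

lemma degree_eq_Suc_if_degree_div:
  fixes U V :: "'a::field poly"
  assumes "degree (U div V) = 1"
  shows "degree U = Suc (degree V)"
proof -
  \<comment> \<open>Division by zero yields 0, of degree 0, so a quotient of degree one excludes
    \<open>V = 0\<close>.\<close>
  have nz: "V \<noteq> 0" "U div V \<noteq> 0" using assms by auto
  then have deg: "degree (U div V * V) = Suc (degree V)"
    using assms by (simp add: degree_mult_eq)
  have "degree (U div V * V + U mod V) = degree (U div V * V)"
    by (rule degree_add_eq_left) (use degree_mod_less[of V U] nz deg in auto)
  then show ?thesis using deg by simp
qed

lemma degree_div_if_degree_eq_Suc:
  fixes U V :: "'a::field poly"
  assumes "degree U = Suc (degree V)" "V \<noteq> 0"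
  shows "degree (U div V) = 1"
proof -
  have nz: "U div V \<noteq> 0" using assms by (auto simp: div_poly_eq_0_iff)
  then have deg: "degree (U div V * V) = degree (U div V) + degree V"
    using assms by (simp add: degree_mult_eq)
  have "degree (U div V * V + U mod V) = degree (U div V * V)"
    by (rule degree_add_eq_left) (use degree_mod_less[of V U] assms deg in auto)
  then show ?thesis using deg assms by simp
qed

text \<open>Linear quotients make the degrees of the remainders drop by exactly one per step. In
  this form the condition can be verified for the truncated pair.\<close>

lemma valid_input_normal_rem_seq:
  assumes "valid_input P Q k"
  shows "normal_rem_seq P Q k"
proof -
  have "i \<le> k \<Longrightarrow> degree (rem_seq P Q i) + i = degree P" for i
  proof (induction i)
    case (Suc i)
    from assms Suc.prems have "matpoly_degree (Bmat P Q (Suc i)) = 1"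
      by (simp add: valid_input_def)
    then have "degree (rem_seq P Q i div rem_seq P Q (Suc i)) = 1"
      by (simp add: Bmat_def matpoly_degree_mat22)
    from degree_eq_Suc_if_degree_div[OF this] Suc show ?case by simp
  qed simp
  with assms show ?thesis by (auto simp: normal_rem_seq_def valid_input_def)
qed

text \<open>By \<open>2 * k \<le> degree P\<close>, these remainders have degree at least
  \<open>k\<close>, which is positive.\<close>

lemma rem_seq_nonzero: "normal_rem_seq P Q k \<Longrightarrow> 1 \<le> k \<Longrightarrow> i \<le> k \<Longrightarrow> rem_seq P Q i \<noteq> 0"
  by (force simp: normal_rem_seq_def)

lemma degree_rem_seq_div:
  assumes "normal_rem_seq P Q k" "Suc i \<le> k"
  shows "degree (rem_seq P Q i div rem_seq P Q (Suc i)) = 1"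
proof (rule degree_div_if_degree_eq_Suc)
  have "degree (rem_seq P Q i) + i = degree P" "degree (rem_seq P Q (Suc i)) + Suc i = degree P"
    using assms unfolding normal_rem_seq_def by (blast dest: Suc_leD)+
  then show "degree (rem_seq P Q i) = Suc (degree (rem_seq P Q (Suc i)))" by simp
  show "rem_seq P Q (Suc i) \<noteq> 0" using rem_seq_nonzero[OF assms(1)] assms(2) by auto
qed

text \<open>A quotient of degree at most one depends only on the leading coefficients. With
  \<open>q = U div V\<close>, the shifted candidate remainder \<open>x ^ e * (U' - q * V')\<close>
  is \<open>U mod V\<close> plus the two approximation errors, all of degree below
  \<open>degree V = degree V' + e\<close>. Multiplication by \<open>q\<close> may raise the degree
  by one, hence the stricter bound on the error of \<open>V\<close>.\<close>

lemma div_poly_cong_high: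
  fixes U V U' V' :: "'a::field poly"
  assumes "V' \<noteq> 0" "degree V = degree V' + e" "1 \<le> degree V"
    and "degree (U div V) \<le> 1"
    and U: "deg_below (degree V) (U - monom 1 e * U')"
    and V: "deg_below (degree V - 1) (V - monom 1 e * V')"
  shows "U' div V' = U div V"
proof -
  define q where "q = U div V"
  define r where "r = U' - q * V'"
  have eq: "monom 1 e * r = (U mod V - (U - monom 1 e * U')) + q * (V - monom 1 e * V')"
    by (simp add: r_def q_def algebra_simps minus_mod_eq_mult_div[symmetric] mult.commute)
  have "V \<noteq> 0" using assms(3) by auto
  then have "deg_below (degree V) (U mod V)"
    using degree_mod_less[of V U] by (auto simp: deg_below_def coeff_eq_0)
  moreover have "deg_below (degree V) (q * (V - monom 1 e * V'))"
    using deg_below_mult[OF V, of q 1] assms(3,4) by (simp add: q_def)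
  ultimately have "deg_below (degree V) (monom 1 e * r)"
    using U unfolding eq by (auto simp: deg_below_def)
  then have *: "coeff r m = 0" if "degree V' \<le> m" for m
    using that assms(2) unfolding deg_below_def
    by (auto simp: coeff_monom_mult dest: spec[of _ "m + e"])
  have "r div V' = 0"
    using *[of "degree r"] by (fastforce simp: div_poly_eq_0_iff not_le[symmetric])
  moreover have "U' = q * V' + r" by (simp add: r_def)
  ultimately show ?thesis
    using assms(1) by (simp add: q_def)
qed

lemma rem_seq_Suc_Suc_eq:
  "rem_seq P Q (Suc (Suc i)) =
    rem_seq P Q i - (rem_seq P Q i div rem_seq P Q (Suc i)) * rem_seq P Q (Suc i)"
  by (simp add: minus_div_mult_eq_mod)

text \<open>Both claims come from one induction. Shifted back by \<open>e\<close>, the truncated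
  remainder \<open>?S i\<close> differs from \<open>?R i\<close> only below index
  \<open>e + (i - 1)\<close>; for \<open>i = 0\<close> and \<open>i = 1\<close>, subtraction on
  naturals makes this the cut-off \<open>e\<close> itself. Since \<open>?R i\<close> has degree
  \<open>2 * k + e - i\<close>, enough leading coefficients agree to fix the degree and the
  quotient.\<close>

lemma
  fixes P Q :: "'a::field poly"
  assumes normal: "normal_rem_seq P Q k"
  defines "e \<equiv> degree P - 2 * k"
  shows normal_rem_seq_tail: "normal_rem_seq (tail P e) (tail Q e) k"
    and Bmat_tail: "\<And>i. Suc i \<le> k \<Longrightarrow> Bmat (tail P e) (tail Q e) (Suc i) = Bmat P Q (Suc i)"
proof -
  let ?R = "rem_seq P Q" and ?S = "rem_seq (tail P e) (tail Q e)"
  let ?close = "\<lambda>i. deg_below (e + (i - 1)) (?R i - monom 1 e * ?S i)"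
  have d: "degree P = 2 * k + e" "degree (?R i) + i = degree P" if "i \<le> k" for i
    using normal that by (auto simp: normal_rem_seq_def e_def)
  have degS: "degree (?S i) + i = 2 * k \<and> (1 \<le> k \<longrightarrow> ?S i \<noteq> 0)" if i: "i \<le> k" and c: "?close i" for i
  proof -
    have co: "coeff (?S i) m = coeff (?R i) (m + e)" if "i - 1 \<le> m" for m
      using that c unfolding deg_below_def by (auto simp: coeff_monom_mult dest: spec[of _ "m + e"])
    have degR: "degree (?R i) = (2 * k - i) + e" using d[OF i] i by simp
    have zero: "coeff (?S i) m = 0" if "2 * k - i < m" for m
      using co[of m] that i degR by (auto intro: coeff_eq_0)
    show ?thesis
    proof (cases "k = 0")
      case True
      have "degree (?S i) \<le> 2 * k - i" by (rule degree_le) (use zero in blast)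
      with True i show ?thesis by simp
    next
      case False
      then have "?R i \<noteq> 0" using rem_seq_nonzero[OF normal] i by auto
      \<comment> \<open>As \<open>i - 1 \<le> 2 * k - i\<close>, the leading coefficient of
        \<open>?R i\<close> lies in the range of agreement.\<close>
      then have nz: "coeff (?S i) (2 * k - i) \<noteq> 0"
        using co[of "2 * k - i"] i degR leading_coeff_0_iff[of "?R i"] by auto
      have "degree (?S i) = 2 * k - i"
        by (intro antisym degree_le le_degree) (use nz zero in auto)
      then show ?thesis using nz i by auto
    qed
  qed
  have quot: "?S i div ?S (Suc i) = ?R i div ?R (Suc i)"
    if i: "Suc i \<le> k" and c: "?close i" "?close (Suc i)" for i
  proof (rule div_poly_cong_high)
    note 1 = degS[OF i c(2)] d[OF i]
    show "?S (Suc i) \<noteq> 0" using 1 i by auto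
    show "degree (?R (Suc i)) = degree (?S (Suc i)) + e" using 1 by simp
    show "1 \<le> degree (?R (Suc i))" using 1 i by simp
    show "degree (?R i div ?R (Suc i)) \<le> 1" using degree_rem_seq_div[OF normal i] by simp
    show "deg_below (degree (?R (Suc i))) (?R i - monom 1 e * ?S i)"
      by (rule deg_below_mono[OF c(1)]) (use 1 i in simp)
    \<comment> \<open>Here \<open>e + i \<le> 2 * k + e - i - 2\<close> is required, which is
      \<open>Suc i \<le> k\<close>; at the last quotient there is no slack.\<close>
    show "deg_below (degree (?R (Suc i)) - 1) (?R (Suc i) - monom 1 e * ?S (Suc i))"
      by (rule deg_below_mono[OF c(2)]) (use 1 i in simp)
  qed
  have close: "?close i \<and> ?close (Suc i)" if "i \<le> k" for i
    using that
  proof (induction i)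
    case 0
    show ?case by (simp add: deg_below_def coeff_monom_mult)
  next
    case (Suc i)
    then have c: "?close i" "?close (Suc i)" by auto
    define q where "q = ?R i div ?R (Suc i)"
    have q: "?S i div ?S (Suc i) = q" "degree q \<le> 1"
      using quot[OF Suc.prems c] degree_rem_seq_div[OF normal Suc.prems] by (auto simp: q_def)
    \<comment> \<open>Equal quotients make the errors obey the recursion of the remainders; the
      factor \<open>q\<close> raises the bound by one.\<close>
    have "?R (Suc (Suc i)) - monom 1 e * ?S (Suc (Suc i)) =
        (?R i - monom 1 e * ?S i) - q * (?R (Suc i) - monom 1 e * ?S (Suc i))"
      unfolding rem_seq_Suc_Suc_eq q(1) q_def[symmetric] by (simp add: algebra_simps)
    moreover have "deg_below (e + Suc i) (?R i - monom 1 e * ?S i)"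
      by (rule deg_below_mono[OF c(1)]) simp
    moreover have "deg_below (e + Suc i) (q * (?R (Suc i) - monom 1 e * ?S (Suc i)))"
      by (rule deg_below_mono[OF deg_below_mult[OF c(2) q(2)]]) simp
    ultimately show ?case using c deg_below_diff by simp
  qed
  have "degree (tail P e) = 2 * k" using d[of 0] by (simp add: degree_tail)
  then show "normal_rem_seq (tail P e) (tail Q e) k"
    unfolding normal_rem_seq_def using degS close by auto
  show "Bmat (tail P e) (tail Q e) (Suc i) = Bmat P Q (Suc i)" if "Suc i \<le> k" for i
    using quot[OF that] close[of i] that by (simp add: Bmat_def)
qed

section \<open>Composition of remainder sequences and of their transition matrices\<close>

lemma rem_seq_shift:
  "rem_seq (rem_seq P Q h) (rem_seq P Q (Suc h)) j = rem_seq P Q (h + j)"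
proof -
  have "rem_seq (rem_seq P Q h) (rem_seq P Q (Suc h)) j = rem_seq P Q (h + j) \<and>
    rem_seq (rem_seq P Q h) (rem_seq P Q (Suc h)) (Suc j) = rem_seq P Q (h + Suc j)"
    by (induction j) simp_all
  then show ?thesis ..
qed

lemma Bprod_1_Suc: "Bprod P Q 1 (Suc (Suc n)) = Bmat P Q (Suc n) ** Bprod P Q 1 (Suc n)"
  by simp

lemma Bprod_1_1: "Bprod P Q 1 (Suc 0) = mat 1"
  by simp

text \<open>The factorisation behind the two recursive calls: after \<open>h\<close> steps the
  sequence restarts from the remainders of index \<open>h\<close> and \<open>Suc h\<close>.\<close>

lemma Bprod_shift:
  "Bprod P Q 1 (Suc (h + j)) =
    Bprod (rem_seq P Q h) (rem_seq P Q (Suc h)) 1 (Suc j) ** Bprod P Q 1 (Suc h)"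
proof (induction j)
  case 0
  show ?case by (simp only: Bprod_1_1 matrix_mul_lid) simp
next
  case (Suc j)
  have "Bmat (rem_seq P Q h) (rem_seq P Q (Suc h)) (Suc j) = Bmat P Q (Suc (h + j))"
    by (simp add: Bmat_def rem_seq_shift)
  with Suc show ?case
    unfolding add_Suc_right Bprod_1_Suc by (simp add: matrix_mul_assoc)
qed

lemma Bprod_cong:
  assumes "\<And>i. Suc i \<le> k \<Longrightarrow> Bmat P Q (Suc i) = Bmat P' Q' (Suc i)"
  shows "Bprod P Q 1 (Suc k) = Bprod P' Q' 1 (Suc k)"
  using assms
proof (induction k)
  case (Suc k)
  then show ?case unfolding Bprod_1_Suc by simp
qed simp

lemma Bprod_tail:
  "normal_rem_seq P Q k \<Longrightarrow>
    Bprod (tail P (degree P - 2 * k)) (tail Q (degree P - 2 * k)) 1 (Suc k) = Bprod P Q 1 (Suc k)"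
  by (intro Bprod_cong Bmat_tail)

lemma normal_rem_seq_shift:
  assumes "normal_rem_seq P Q (h + j)"
  shows "normal_rem_seq (rem_seq P Q h) (rem_seq P Q (Suc h)) j"
  unfolding normal_rem_seq_def rem_seq_shift
proof (intro conjI allI impI)
  have deg: "degree (rem_seq P Q (h + i)) + (h + i) = degree P" if "i \<le> j" for i
    using assms that by (simp add: normal_rem_seq_def)
  have "2 * (h + j) \<le> degree P" using assms by (simp add: normal_rem_seq_def)
  then show "2 * j \<le> degree (rem_seq P Q h)" using deg[of 0] by simp
  show "degree (rem_seq P Q (h + i)) + i = degree (rem_seq P Q h)" if "i \<le> j" for i
    using deg[of 0] deg[OF that] by simp
qed

lemma normal_rem_seq_le: "normal_rem_seq P Q k \<Longrightarrow> h \<le> k \<Longrightarrow> normal_rem_seq P Q h"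
  by (auto simp: normal_rem_seq_def)

lemma Bmat_mult_nth:
  fixes A :: "'a::field poly^2^2"
  shows "(Bmat P Q (Suc n) ** A) $ 1 $ j = A $ 2 $ j"
  "(Bmat P Q (Suc n) ** A) $ 2 $ j =
    A $ 1 $ j - (rem_seq P Q n div rem_seq P Q (Suc n)) * A $ 2 $ j"
  by (simp_all add: matrix_mult_2_nth Bmat_def)

lemma mat_1_nth_2 [simp]:
  "(mat 1 :: 'a::zero_neq_one^2^2) $ 1 $ 1 = 1" "(mat 1 :: 'a^2^2) $ 1 $ 2 = 0"
  "(mat 1 :: 'a^2^2) $ 2 $ 1 = 0" "(mat 1 :: 'a^2^2) $ 2 $ 2 = 1"
  by (simp_all add: mat_def)

text \<open>Identifies the updated pair of the algorithm with two consecutive remainders, from which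
  the second call starts.\<close>

lemma Bprod_rem_seq:
  "Bprod P Q 1 (Suc n) $ 1 $ 1 * P + Bprod P Q 1 (Suc n) $ 1 $ 2 * Q = rem_seq P Q n \<and>
   Bprod P Q 1 (Suc n) $ 2 $ 1 * P + Bprod P Q 1 (Suc n) $ 2 $ 2 * Q = rem_seq P Q (Suc n)"
proof (induction n)
  case (Suc n)
  have "(a - q * c) * P + (b - q * d) * Q = (a * P + b * Q) - q * (c * P + d * Q)" for a b c d q
    by (simp add: algebra_simps)
  with Suc show ?case
    unfolding Bprod_1_Suc Bmat_mult_nth rem_seq_Suc_Suc_eq by simp
qed simp

text \<open>Each linear quotient raises the degree by at most one. FFT doubling and the cyclic
  products rely on this bound.\<close>

lemma degree_Bprod:
  assumes "normal_rem_seq P Q k"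
  shows "degree (Bprod P Q 1 (Suc k) $ i $ j) \<le> k"
proof -
  have "\<forall>i j. degree (Bprod P Q 1 (Suc n) $ i $ j) \<le> n" if "n \<le> k" for n
    using that
  proof (induction n)
    case 0
    show ?case by (simp add: forall_2)
  next
    case (Suc n)
    let ?q = "rem_seq P Q n div rem_seq P Q (Suc n)"
    have IH: "degree (Bprod P Q 1 (Suc n) $ i $ j) \<le> n" for i j using Suc by auto
    have "degree (?q * Bprod P Q 1 (Suc n) $ 2 $ j) \<le> Suc n" for j
      using degree_mult_le[of ?q "Bprod P Q 1 (Suc n) $ 2 $ j"] IH[of 2 j]
        degree_rem_seq_div[OF assms Suc.prems] by simp
    then show ?case
      unfolding Bprod_1_Suc forall_2 Bmat_mult_nth
      using IH[of 1] IH[of 2] by (blast intro: degree_diff_le le_SucI)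
  qed
  then show ?thesis by auto
qed

section \<open>Discrete Fourier transforms\<close>

lemma poly_conv_sum_below:
  fixes U :: "'a::comm_ring_1 poly"
  assumes "deg_below n U"
  shows "poly U x = (\<Sum>i<n. coeff U i * x ^ i)"
proof -
  have "poly U x = (\<Sum>i\<le>degree U. coeff U i * x ^ i)" by (rule poly_altdef)
  \<comment> \<open>The maximum covers \<open>n = 0\<close>, where \<open>U = 0\<close> still has
    degree 0.\<close>
  also have "\<dots> = (\<Sum>i<max n (Suc (degree U)). coeff U i * x ^ i)"
    by (intro sum.mono_neutral_left) (auto simp: coeff_eq_0)
  also have "\<dots> = (\<Sum>i<n. coeff U i * x ^ i)"
    using assms by (intro sum.mono_neutral_right) (auto simp: deg_below_def)
  finally show ?thesis .
qed

lemma poly_Poly: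
  fixes us :: "'a::comm_ring_1 list"
  shows "poly (Poly us) x = (\<Sum>i<length us. us ! i * x ^ i)"
  using poly_conv_sum_below[of "length us" "Poly us"] by (simp add: deg_below_def nth_default_def)

lemma splice_map_even_odd:
  "splice (map (\<lambda>i. f (2 * i)) [0..<n]) (map (\<lambda>i. f (Suc (2 * i))) [0..<n]) = map f [0..<2 * n]"
proof (induction n arbitrary: f)
  case (Suc n)
  have *: "map g [0..<Suc m] = g 0 # map (\<lambda>i. g (Suc i)) [0..<m]" for g :: "nat \<Rightarrow> 'a" and m
    by (simp add: map_upt_Suc del: upt_Suc)
  show ?case
    using Suc[of "\<lambda>i. f (Suc (Suc i))"] by (simp add: * del: upt_Suc)
qed simp

lemma sum_lessThan_add:
  fixes f :: "nat \<Rightarrow> 'a::comm_monoid_add"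
  shows "(\<Sum>i<m + n. f i) = (\<Sum>i<m. f i) + (\<Sum>i<n. f (m + i))"
  by (induction n) (simp_all add: add.assoc)

lemma power_root_of_unity:
  fixes w :: "'a::comm_monoid_mult"
  shows "w ^ n = 1 \<Longrightarrow> (w ^ i) ^ n = 1"
  by (simp add: power_mult[symmetric] mult.commute[of i]) (simp add: power_mult)

text \<open>At an \<open>n\<close>-th root of unity only \<open>W\<close> modulo
  \<open>x ^ n - 1\<close> matters, so the upper half of the coefficients folds onto the lower
  half.\<close>

lemma poly_DFT_cyclic:
  fixes W :: "'a::field poly"
  assumes "x ^ n = 1" "deg_below (2 * n) W"
  shows "poly W x = poly (Poly (map (\<lambda>i. coeff W i + coeff W (i + n)) [0..<n])) x"
proof -
  have "poly W x = (\<Sum>i<n + n. coeff W i * x ^ i)"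
    using poly_conv_sum_below[OF assms(2)] by (simp add: mult_2)
  also have "\<dots> = (\<Sum>i<n. coeff W i * x ^ i) + (\<Sum>i<n. coeff W (i + n) * x ^ (i + n))"
    by (simp add: sum_lessThan_add add.commute)
  finally show ?thesis
    using assms(1) by (simp add: poly_Poly power_add distrib_right sum.distrib)
qed

lemma primitive_root_of_unity_inj_on:
  assumes "primitive_root_of_unity n w"
  shows "inj_on (\<lambda>i. w ^ i) {..<n}"
proof (rule linorder_inj_onI')
  fix i j assume ij: "i \<in> {..<n}" "j \<in> {..<n}" "i < j"
  have w: "w ^ n = 1" "0 < n" "\<And>m. 0 < m \<Longrightarrow> m < n \<Longrightarrow> w ^ m \<noteq> 1"
    using assms by (auto simp: primitive_root_of_unity_def)
  then have "w \<noteq> 0" by (auto simp: zero_power)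
  have "w ^ j = w ^ i * w ^ (j - i)" using ij by (simp flip: power_add)
  with \<open>w \<noteq> 0\<close> w(3)[of "j - i"] ij show "w ^ i \<noteq> w ^ j" by auto
qed

context binary_fft_model
begin

lemma orders_pos: "n \<in> orders \<Longrightarrow> 0 < n"
  using orders_power_of_two by fastforce

lemma \<omega>_power_order: "n \<in> orders \<Longrightarrow> \<omega> n ^ n = 1"
  using \<omega>_primitive by (auto simp: primitive_root_of_unity_def)

text \<open>A nonzero difference would have degree less than \<open>n\<close> but \<open>n\<close>
  distinct roots.\<close>

lemma DFT_inj:
  assumes "n \<in> orders" "DFT \<omega> n U = DFT \<omega> n V" "deg_below n U" "deg_below n V"
  shows "U = V"
proof (rule poly_eqI_degree)
  show "poly U x = poly V x" if "x \<in> (\<lambda>i. \<omega> n ^ i) ` {..<n}" for x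
    using assms(2) that by (auto simp: DFT_def)
  have card: "card ((\<lambda>i. \<omega> n ^ i) ` {..<n}) = n"
    using primitive_root_of_unity_inj_on[OF \<omega>_primitive[OF assms(1)]] by (simp add: card_image)
  have "degree W < n" if "deg_below n W" for W :: "'a poly"
    using that orders_pos[OF assms(1)] unfolding deg_below_def
    by (metis degree_0 leading_coeff_0_iff not_le)
  then show "degree U < card ((\<lambda>i. \<omega> n ^ i) ` {..<n})" "degree V < card ((\<lambda>i. \<omega> n ^ i) ` {..<n})"
    using assms(3,4) unfolding card by auto
qed

lemma computes_dft:
  "n \<in> orders \<Longrightarrow> length us = n \<Longrightarrow> computes (run_prog (dft n) us) (DFT \<omega> n (Poly us)) (F n)"
  using computes_mono[OF computes_run_prog dft_cost] by (simp add: dft_correct)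

text \<open>Stated for transforms of polynomials that may have degree \<open>n\<close> or more, as
  they arise from products; the inverse then returns the cyclic folding, by uniqueness of
  interpolation.\<close>

lemma computes_idft:
  assumes "n \<in> orders" "deg_below (2 * n) W"
  shows "computes (run_prog (idft n) (DFT \<omega> n W))
    (map (\<lambda>i. coeff W i + coeff W (i + n)) [0..<n]) (F n)"
proof -
  let ?r = "result (run_prog (idft n) (DFT \<omega> n W))"
  let ?w = "map (\<lambda>i. coeff W i + coeff W (i + n)) [0..<n]"
  have r: "length ?r = n" "DFT \<omega> n (Poly ?r) = DFT \<omega> n W"
    using idft_correct[OF assms(1), of "DFT \<omega> n W"] by auto
  have "(\<omega> n ^ i) ^ n = 1" for i
    by (rule power_root_of_unity[OF \<omega>_power_order[OF assms(1)]])
  then have "DFT \<omega> n W = DFT \<omega> n (Poly ?w)"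
    using poly_DFT_cyclic[OF _ assms(2)] by (simp add: DFT_def)
  with r have "Poly ?r = Poly ?w"
    by (intro DFT_inj[OF assms(1)]) (auto simp: deg_below_def nth_default_def)
  \<comment> \<open>\<open>Poly\<close> forgets trailing zeros, so the lists are recovered from
    padded coefficients and their common length.\<close>
  then have co: "nth_default 0 ?r = nth_default 0 ?w" by (metis coeff_Poly_eq)
  have "?r = ?w"
  proof (rule nth_equalityI)
    fix i assume "i < length ?r"
    with r(1) fun_cong[OF co, of i] show "?r ! i = ?w ! i" by (simp add: nth_default_def)
  qed (simp add: r)
  then show ?thesis
    using computes_mono[OF computes_run_prog idft_cost[OF assms(1), of "DFT \<omega> n W"]] by simp
qed

lemma \<omega>_half: "2 * h \<in> orders \<Longrightarrow> \<omega> h = \<omega> (2 * h) ^ 2"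
  using \<omega>_compatible[of "2 * h" h] orders_pos[of "2 * h"] by simp

text \<open>The even powers of the root give the known transform. An odd power is the root times a
  power of \<open>\<omega> h\<close>, so scaling coefficient \<open>i\<close> by the
  \<open>i\<close>-th power of the root reduces the rest to order \<open>h\<close>. The count is
  \<open>h\<close> for the powers, \<open>h + 1\<close> for the scaling, one for the folding and
  \<open>F h\<close>.\<close>

lemma computes_fft_double:
  assumes "2 * h \<in> orders" "degree U \<le> h"
  shows "computes (fft_double \<omega> dft (2 * h) U (DFT \<omega> h U)) (DFT \<omega> (2 * h) U)
    (F h + 2 * real h + 2)"
proof -
  let ?w = "\<omega> (2 * h)"
  have h: "h \<in> orders" using orders_dvd[OF assms(1), of h] by simp
  have "0 < h" using orders_pos[OF h] .
  define us where "us = map2 (apply_arith Mul) (slice U 0 (h + 1)) (map (\<lambda>i. ?w ^ i) [0..<Suc h])"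
  have len: "length us = Suc h" by (simp add: us_def)
  have us: "us ! i = coeff U i * ?w ^ i" if "i \<le> h" for i
    using that by (simp add: us_def del: upt_Suc)
  define vs where "vs = apply_arith Add (us ! 0) (us ! h) # tl (take h us)"
  have "poly (Poly vs) (\<omega> h ^ j) = poly U (?w ^ Suc (2 * j))" for j
  proof -
    let ?x = "\<omega> h ^ j"
    have x: "?x ^ h = 1"
      by (rule power_root_of_unity[OF \<omega>_power_order[OF h]])
    have y: "(?w ^ Suc (2 * j)) ^ i = ?w ^ i * ?x ^ i" for i
      unfolding \<omega>_half[OF assms(1)] by (simp add: power_mult power_mult_distrib)
    obtain g where g: "h = Suc g" using \<open>0 < h\<close> by (cases h) auto
    have vs_nth: "vs ! Suc i = us ! Suc i" if "i < g" for i
      using that len g by (simp add: vs_def nth_tl)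
    have vs_len: "length vs = h" using len \<open>0 < h\<close> by (simp add: vs_def)
    have vs_0: "vs ! 0 = us ! 0 + us ! h" by (simp add: vs_def)
    have "poly (Poly vs) ?x = us ! 0 + us ! h + (\<Sum>i<g. us ! Suc i * ?x ^ Suc i)"
      unfolding poly_Poly vs_len unfolding g sum.lessThan_Suc_shift
      using vs_nth vs_0 g by simp
    \<comment> \<open>As \<open>?x ^ h = 1\<close>, the folded \<open>us ! h\<close> can be moved
      back to its place as the term of index \<open>h\<close>.\<close>
    also have "\<dots> = (\<Sum>i<Suc h. us ! i * ?x ^ i)"
      unfolding sum.lessThan_Suc[of _ h] using x
      unfolding g sum.lessThan_Suc_shift by (simp add: algebra_simps del: sum.lessThan_Suc)
    also have "\<dots> = (\<Sum>i<Suc h. coeff U i * (?w ^ Suc (2 * j)) ^ i)"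
      unfolding y by (intro sum.cong) (simp_all add: us)
    also have "\<dots> = poly U (?w ^ Suc (2 * j))"
      by (rule poly_conv_sum_below[symmetric]) (use assms(2) in \<open>auto simp: deg_below_def coeff_eq_0\<close>)
    finally show ?thesis .
  qed
  then have "DFT \<omega> h (Poly vs) = map (\<lambda>i. poly U (?w ^ Suc (2 * i))) [0..<h]"
    by (simp add: DFT_def)
  moreover have "DFT \<omega> h U = map (\<lambda>i. poly U (?w ^ (2 * i))) [0..<h]"
    by (simp add: DFT_def \<omega>_half[OF assms(1)] power_mult)
  ultimately have spl: "splice (DFT \<omega> h U) (DFT \<omega> h (Poly vs)) = DFT \<omega> (2 * h) U"
    using splice_map_even_odd[of "\<lambda>i. poly U (?w ^ i)" h] by (simp only: DFT_def)
  have div: "2 * h div 2 = h" by simp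
  have 1: "computes (zip_op Mul (slice U 0 (h + 1)) (map (\<lambda>i. ?w ^ i) [0..<Suc h])) us (real (h + 1))"
    unfolding us_def using computes_zip_op[of "slice U 0 (h + 1)" "map (\<lambda>i. ?w ^ i) [0..<Suc h]" Mul]
    by (simp del: upt_Suc apply_arith.simps)
  have 2: "computes (run_prog (dft h) (apply_arith Add (us ! 0) (us ! h) # tl (take h us)))
      (DFT \<omega> h (Poly vs)) (F h)"
    unfolding vs_def by (rule computes_dft[OF h]) (use len \<open>0 < h\<close> in simp)
  have 3: "computes (fft_double \<omega> dft (2 * h) U (DFT \<omega> h U)) (splice (DFT \<omega> h U) (DFT \<omega> h (Poly vs)))
    (real h + (real (h + 1) + (1 + (F h + 0))))"
    unfolding fft_double_def Let_def div
    by (rule computes_bind computes_powers_op 1 2 computes_arith computes_return)+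
  show ?thesis
    using 3 unfolding spl by (rule computes_mono) simp
qed

end

section \<open>One level of the recursion\<close>

lemma slice_append: "i \<le> j \<Longrightarrow> j \<le> l \<Longrightarrow> slice U i j @ slice U j l = slice U i l"
  using upt_add_eq_append[of i j "l - j"] by (simp add: slice_def)

text \<open>Coefficient \<open>h + j\<close> of the product uses indices \<open>h + j - i\<close>
  with \<open>i \<le> h\<close>, all inside the window of length \<open>2 * h\<close>.\<close>

lemma coeff_mult_slice:
  fixes a :: "'a::comm_ring_1 poly"
  assumes "degree a \<le> h" "j < h"
  shows "coeff (a * Poly (slice U s (s + 2 * h))) (h + j) = coeff (a * U) (s + h + j)"
proof -
  have "coeff (a * U) (s + h + j) = (\<Sum>i\<le>s + h + j. coeff a i * coeff U (s + h + j - i))"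
    by (rule coeff_mult)
  also have "\<dots> = (\<Sum>i\<le>h + j. coeff a i * coeff U (s + h + j - i))"
    using assms by (intro sum.mono_neutral_right) (auto simp: coeff_eq_0)
  also have "\<dots> = (\<Sum>i\<le>h + j. coeff a i * coeff (Poly (slice U s (s + 2 * h))) (h + j - i))"
    using assms by (intro sum.cong) (auto simp: nth_default_def add.assoc)
  finally show ?thesis by (simp add: coeff_mult)
qed

text \<open>The windowed product has degree below \<open>3 * h\<close>, so wrap-around at order
  \<open>2 * h\<close> reaches only the \<open>h\<close> lowest coefficients, which are dropped; the
  others agree with those of the full product.\<close>

lemma drop_cyclic_product:
  fixes a b U V :: "'a::comm_ring_1 poly" and s :: nat
  assumes "degree a \<le> h" "degree b \<le> h"
  defines "W \<equiv> a * Poly (slice U s (s + 2 * h)) + b * Poly (slice V s (s + 2 * h))"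
  shows "deg_below (3 * h) W"
    and "drop h (map (\<lambda>m. coeff W m + coeff W (m + 2 * h)) [0..<2 * h]) =
      slice (a * U + b * V) (s + h) (s + 2 * h)"
proof -
  have "deg_below (2 * h) (Poly (slice X s (s + 2 * h)))" for X :: "'a poly"
    by (simp add: deg_below_def nth_default_def)
  from deg_below_mult[OF this assms(1), of U] deg_below_mult[OF this assms(2), of V]
  show W: "deg_below (3 * h) W" by (simp add: deg_below_def W_def)
  show "drop h (map (\<lambda>m. coeff W m + coeff W (m + 2 * h)) [0..<2 * h]) =
      slice (a * U + b * V) (s + h) (s + 2 * h)" (is "?l = ?r")
  proof (rule nth_equalityI)
    fix j assume "j < length ?l"
    then have "j < h" by simp
    then show "?l ! j = ?r ! j"
      using W coeff_mult_slice[OF assms(1), of j] coeff_mult_slice[OF assms(2), of j]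
      by (simp add: deg_below_def W_def)
  qed simp
qed

lemma coeff_mult_conv_sum:
  fixes a :: "'a::comm_ring_1 poly"
  assumes "degree a \<le> h" "h \<le> n"
  shows "coeff (a * U) n = (\<Sum>i<Suc h. coeff a i * coeff U (n - i))"
  unfolding coeff_mult lessThan_Suc_atMost
  using assms by (intro sum.mono_neutral_right) (auto simp: coeff_eq_0)

text \<open>Both \<open>i\<close> and \<open>2 * h - i\<close> are at most \<open>h\<close> only for
  \<open>i = h\<close>. This is the coefficient known before the final cyclic product is
  unfolded.\<close>

lemma coeff_mult_top:
  fixes a b :: "'a::comm_ring_1 poly"
  assumes "degree a \<le> h" "degree b \<le> h"
  shows "coeff (a * b) (2 * h) = coeff a h * coeff b h"
proof -
  have "coeff a i * coeff b (2 * h - i) = (if i = h then coeff a h * coeff b h else 0)"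
    if "i \<le> 2 * h" for i
  proof (cases "i \<le> h")
    case True
    then show ?thesis using assms(2) by (auto simp: coeff_eq_0 mult_2)
  qed (use assms(1) in \<open>auto simp: coeff_eq_0\<close>)
  then show ?thesis by (simp add: coeff_mult)
qed

section \<open>The case \<open>k = 1\<close>\<close>

lemma div_poly_linear:
  fixes U V :: "'a::field poly"
  assumes "degree U = Suc (Suc n)" "degree V = Suc n"
  defines "q1 \<equiv> coeff U (Suc (Suc n)) / coeff V (Suc n)"
  defines "q0 \<equiv> (coeff U (Suc n) - q1 * coeff V n) / coeff V (Suc n)"
  shows "U div V = [:q0, q1:]"
proof -
  define r where "r = U - [:q0, q1:] * V"
  have V: "coeff V (Suc n) \<noteq> 0" using assms(2) leading_coeff_0_iff[of V] by auto
  have "coeff r m = 0" if m: "Suc n \<le> m" for m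
  proof -
    obtain l where l: "m = Suc l" using m by (cases m) auto
    have co: "coeff r m = coeff U (Suc l) - (q0 * coeff V (Suc l) + q1 * coeff V l)"
      by (simp add: r_def l)
    \<comment> \<open>The choice of \<open>q0\<close> cancels the first of these coefficients and
      \<open>q1\<close> the second; above them everything exceeds the degrees.\<close>
    consider "l = n" | "l = Suc n" | "Suc n < l" using m l by linarith
    then show ?thesis
    proof cases
      case 1
      then show ?thesis using co V by (simp add: q0_def)
    next
      case 2
      then show ?thesis using co V assms(2) by (simp add: q1_def coeff_eq_0)
    next
      case 3
      then show ?thesis using co assms by (simp add: coeff_eq_0)
    qed
  qed
  from this[of "degree r"] have "r div V = 0"
    using assms(2) by (auto simp: div_poly_eq_0_iff)
  moreover have "U = [:q0, q1:] * V + r" by (simp add: r_def)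
  moreover have "V \<noteq> 0" using V by auto
  ultimately show ?thesis by (metis add.right_neutral div_mult_self3)
qed

lemma computes_algorithm_F_base:
  assumes "normal_rem_seq P Q 1"
  shows "computes (algorithm_F_base P Q)
    (Bprod P Q 1 (Suc 1), DFT_mat \<omega> 1 (Bprod P Q 1 (Suc 1))) 7"
proof -
  have d: "2 \<le> degree P" "\<And>i. i \<le> 1 \<Longrightarrow> degree (rem_seq P Q i) + i = degree P"
    using assms by (auto simp: normal_rem_seq_def)
  then obtain n where n: "degree P = Suc (Suc n)" by (metis Suc_le_D numeral_2_eq_2 Suc_le_mono)
  have "degree Q = Suc n" using d(2)[of 1] n by simp
  define q1 where "q1 = coeff P (Suc (Suc n)) / coeff Q (Suc n)"
  define q0 where "q0 = (coeff P (Suc n) - q1 * coeff Q n) / coeff Q (Suc n)"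
  have q: "P div Q = [:q0, q1:]"
    unfolding q0_def q1_def using n \<open>degree Q = Suc n\<close> by (rule div_poly_linear)
  have B: "Bprod P Q 1 (Suc 1) = mat22 0 1 1 [:- q0, - q1:]"
    by (simp add: Bmat_def q)
  \<comment> \<open>The only evaluation point is \<open>\<omega> 1 ^ 0 = 1\<close>.\<close>
  have D: "DFT_mat \<omega> 1 (mat22 0 1 1 [:- q0, - q1:]) = mat22 [0] [1] [1] [- q0 - q1]"
    by (simp add: vec_eq_iff forall_2 DFT_def)
  define r where "r = (mat22 0 1 1 [:apply_arith Sub 0 q0, apply_arith Sub 0 q1:],
        mat22 [0] [1] [1] [apply_arith Add (apply_arith Sub 0 q0) (apply_arith Sub 0 q1)])"
  have eqs: "coeff (tail P (degree P - 2)) 2 = coeff P (Suc (Suc n))"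
    "coeff (tail P (degree P - 2)) 1 = coeff P (Suc n)"
    "coeff (tail Q (degree P - 2)) 1 = coeff Q (Suc n)"
    "coeff (tail Q (degree P - 2)) 0 = coeff Q n"
    by (simp_all add: n)
  have q': "apply_arith Div (coeff P (Suc (Suc n))) (coeff Q (Suc n)) = q1"
    "apply_arith Div (apply_arith Sub (coeff P (Suc n)) (apply_arith Mul q1 (coeff Q n))) (coeff Q (Suc n)) = q0"
    by (simp_all add: q0_def q1_def)
  have "computes (algorithm_F_base P Q) r (1 + (1 + (1 + (1 + (1 + (1 + (1 + 0)))))))"
    unfolding algorithm_F_base_def Let_def eqs r_def q'[symmetric]
    by (rule computes_bind computes_arith computes_return)+
  moreover have "r = (Bprod P Q 1 (Suc 1), DFT_mat \<omega> 1 (Bprod P Q 1 (Suc 1)))"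
    unfolding B D by (simp add: r_def)
  ultimately show ?thesis by simp
qed

lemma computes_case_prod:
  "computes (f a b) r c \<Longrightarrow> computes (case (a, b) of (x, y) \<Rightarrow> f x y) r c"
  by simp

context binary_fft_model
begin

text \<open>Eight transforms, \<open>24 * h\<close> operations for the pointwise matrix product, and
  \<open>4 * (h + 1)\<close> for the single top coefficient.\<close>

lemma computes_algorithm_F_update:
  assumes orders: "2 * h \<in> orders" and normal: "normal_rem_seq P Q (2 * h)"
  defines "A \<equiv> Bprod P Q 1 (Suc h)"
  shows "computes (algorithm_F_update dft idft (2 * h) A (DFT_mat \<omega> (2 * h) A) P Q)
    (tail (rem_seq P Q h) (degree P - 3 * h), tail (rem_seq P Q (Suc h)) (degree P - 3 * h))
    (8 * F (2 * h) + 28 * real h + 4)"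
proof -
  let ?d = "degree P"
  have "0 < h" using orders_pos[OF orders] by simp
  have d: "4 * h \<le> ?d" using normal by (simp add: normal_rem_seq_def)
  \<comment> \<open>The lowest coefficient index that is read.\<close>
  define e where "e = ?d - 4 * h"
  have e: "?d = e + 4 * h" "?d - 4 * h = e" "?d - 3 * h = e + h" "?d - h = e + 3 * h"
    using d by (auto simp: e_def)
  have degA: "degree (A $ i $ j) \<le> h" for i j
    unfolding A_def by (rule degree_Bprod[OF normal_rem_seq_le[OF normal]]) simp
  have degR: "degree (rem_seq P Q h) = e + 3 * h" "degree (rem_seq P Q (Suc h)) + 1 = e + 3 * h"
    using normal \<open>0 < h\<close> e(1) unfolding normal_rem_seq_def
    by (auto dest: spec[of _ h] spec[of _ "Suc h"])
  have R: "A $ 1 $ 1 * P + A $ 1 $ 2 * Q = rem_seq P Q h"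
    "A $ 2 $ 1 * P + A $ 2 $ 2 * Q = rem_seq P Q (Suc h)"
    using Bprod_rem_seq[of P Q h] by (auto simp: A_def)
  define X where "X =
    mat22 (slice P (?d - 4 * h + 0 * h) (?d - 3 * h + 0 * h) @ slice P (?d - 4 * h + 1 * h) (?d - 3 * h + 1 * h))
          (slice P (?d - 4 * h + 1 * h) (?d - 3 * h + 1 * h) @ slice P (?d - 4 * h + 2 * h) (?d - 3 * h + 2 * h))
          (slice Q (?d - 4 * h + 0 * h) (?d - 3 * h + 0 * h) @ slice Q (?d - 4 * h + 1 * h) (?d - 3 * h + 1 * h))
          (slice Q (?d - 4 * h + 1 * h) (?d - 3 * h + 1 * h) @ slice Q (?d - 4 * h + 2 * h) (?d - 3 * h + 2 * h))"
  have idx: "e + 0 * h = e" "e + h + 0 * h = e + h" "e + 1 * h = e + h" "e + h + 1 * h = e + 2 * h"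
    "e + h + 2 * h = e + 3 * h" "e + h + h = e + 2 * h"
    by simp_all
  have blocks: "slice U e (e + h) @ slice U (e + h) (e + 2 * h) = slice U e (e + 2 * h)"
    "slice U (e + h) (e + 2 * h) @ slice U (e + 2 * h) (e + 3 * h) = slice U (e + h) (e + 3 * h)"
    for U :: "'a poly"
    by (simp_all add: slice_append)
  have X: "X = mat22 (slice P e (e + 2 * h)) (slice P (e + h) (e + h + 2 * h))
      (slice Q e (e + 2 * h)) (slice Q (e + h) (e + h + 2 * h))"
    unfolding X_def e(2,3) idx blocks ..
  have lenX: "length (X $ i $ j) = 2 * h" for i j
    by (cases i rule: exhaust_2[THEN disjE]; cases j rule: exhaust_2[THEN disjE]) (auto simp: X)
  define Xp where "Xp = (\<chi> i j. Poly (X $ i $ j))"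
  define W where "W = A ** Xp"
  define Y where "Y = (\<chi> i j. map (\<lambda>m. coeff (W $ i $ j) m + coeff (W $ i $ j) (m + 2 * h)) [0..<2 * h])"
  have W: "W $ i $ 1 = A $ i $ 1 * Poly (slice P e (e + 2 * h)) + A $ i $ 2 * Poly (slice Q e (e + 2 * h))"
    "W $ i $ 2 = A $ i $ 1 * Poly (slice P (e + h) (e + h + 2 * h))
      + A $ i $ 2 * Poly (slice Q (e + h) (e + h + 2 * h))" for i
    by (simp_all add: W_def matrix_mult_2_nth Xp_def X)
  note cyc = drop_cyclic_product[OF degA degA]
  have degW: "deg_below (2 * (2 * h)) (W $ i $ j)" for i j
  proof -
    have "deg_below (3 * h) (W $ i $ 1)" "deg_below (3 * h) (W $ i $ 2)"
      unfolding W by (rule cyc)+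
    then show ?thesis using exhaust_2[of j] by (auto intro: deg_below_mono)
  qed
  have Y: "drop h (Y $ i $ 1) = slice (A $ i $ 1 * P + A $ i $ 2 * Q) (e + h) (e + 2 * h)"
    "drop h (Y $ i $ 2) = slice (A $ i $ 1 * P + A $ i $ 2 * Q) (e + 2 * h) (e + 3 * h)" for i
    using cyc(2)[of i 1 P e i 2 Q] cyc(2)[of i 1 P "e + h" i 2 Q]
    by (simp_all only: Y_def W vec_lambda_beta idx)
  define us where "us = map2 (apply_arith Mul) (slice (A $ 1 $ 1) 0 (h + 1))
      (map (\<lambda>i. coeff P (?d - h - i)) [0..<h + 1])"
  define vs where "vs = map2 (apply_arith Mul) (slice (A $ 1 $ 2) 0 (h + 1))
      (map (\<lambda>i. coeff Q (?d - h - i)) [0..<h + 1])"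
  have sum_eq: "sum_list (map2 (apply_arith Mul) (slice a 0 (h + 1))
      (map (\<lambda>i. coeff U (?d - h - i)) [0..<h + 1])) = coeff (a * U) (?d - h)"
    if "degree a \<le> h" for a U
  proof -
    have "map2 (apply_arith Mul) (slice a 0 (h + 1)) (map (\<lambda>i. coeff U (?d - h - i)) [0..<h + 1])
        = map (\<lambda>i. coeff a i * coeff U (?d - h - i)) [0..<Suc h]"
      by (rule nth_equalityI) (simp_all del: upt_Suc)
    moreover have "h \<le> ?d - h" using e by simp
    ultimately show ?thesis
      using coeff_mult_conv_sum[OF that]
      by (simp add: sum_list_distinct_conv_sum_set atLeast0LessThan del: upt_Suc sum.lessThan_Suc)
  qed
  have top: "sum_list (us @ vs) = coeff (rem_seq P Q h) (?d - h)"
    using sum_eq[OF degA] by (simp add: us_def vs_def R(1)[symmetric] del: upt_Suc)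
  have res: "(Poly (drop h (Y $ 1 $ 1) @ drop h (Y $ 1 $ 2) @ [sum_list (us @ vs)]),
       Poly (drop h (Y $ 2 $ 1) @ drop h (Y $ 2 $ 2))) =
     (tail (rem_seq P Q h) (?d - 3 * h), tail (rem_seq P Q (Suc h)) (?d - 3 * h))"
  proof -
    \<comment> \<open>The first remainder has degree \<open>e + 3 * h\<close>, one beyond the two
      blocks starting at \<open>e + h\<close>; the second has degree one less and fits into
      them.\<close>
    have "[sum_list (us @ vs)] = slice (rem_seq P Q h) (e + 3 * h) (e + 3 * h + 1)"
      unfolding top e(4) by (simp add: slice_def)
    then show ?thesis
      unfolding Y R tail_def degR e(3) by (simp add: slice_append)
  qed
  have div: "2 * h div 2 = h" by simp
  have 1: "computes (build_mat (\<lambda>i j. run_prog (dft (2 * h)) (X $ i $ j))) (DFT_mat \<omega> (2 * h) Xp)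
      (4 * F (2 * h))"
    using computes_dft[OF orders lenX] by (intro computes_build_mat) (simp add: Xp_def)
  have 2: "computes (build_mat (\<lambda>i j. run_prog (idft (2 * h)) (DFT_mat \<omega> (2 * h) W $ i $ j))) Y
      (4 * F (2 * h))"
    using computes_idft[OF orders degW] by (intro computes_build_mat) (simp add: Y_def)
  have 3: "computes (zip_op Mul (slice (A $ 1 $ 1) 0 (h + 1))
      (map (\<lambda>i. coeff P (?d - h - i)) [0..<h + 1])) us (real (h + 1))"
    unfolding us_def
    by (rule computes_mono[OF computes_zip_op]) simp_all
  have 4: "computes (zip_op Mul (slice (A $ 1 $ 2) 0 (h + 1))
      (map (\<lambda>i. coeff Q (?d - h - i)) [0..<h + 1])) vs (real (h + 1))"
    unfolding vs_def
    by (rule computes_mono[OF computes_zip_op]) simp_all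
  have "computes (algorithm_F_update dft idft (2 * h) A (DFT_mat \<omega> (2 * h) A) P Q)
     (Poly (drop h (Y $ 1 $ 1) @ drop h (Y $ 1 $ 2) @ [sum_list (us @ vs)]),
       Poly (drop h (Y $ 2 $ 1) @ drop h (Y $ 2 $ 2)))
     (4 * F (2 * h) + (12 * real (2 * h) + (4 * F (2 * h) +
       (real (h + 1) + (real (h + 1) + (real (length (us @ vs)) + 0))))))"
    unfolding algorithm_F_update_def Let_def div X_def[symmetric]
    by (rule computes_bind 1 computes_mat_mult_op[of _ "2 * h" A Xp, folded W_def] 2 3 4
        computes_sum_op computes_return)+
  then show ?thesis
    unfolding res by (rule computes_mono) (simp add: us_def vs_def del: upt_Suc)
qed

text \<open>The product has degree at most \<open>2 * h\<close>, so in the cyclic product of that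
  order only the constant coefficient is disturbed, by the known leading term
  \<open>C\<close>.\<close>

lemma computes_algorithm_F_combine:
  assumes orders: "2 * h \<in> orders"
    and deg: "\<And>i j. degree (A $ i $ j) \<le> h" "\<And>i j. degree (A' $ i $ j) \<le> h"
  shows "computes (algorithm_F_combine idft (2 * h) A (DFT_mat \<omega> (2 * h) A) A' (DFT_mat \<omega> (2 * h) A'))
    (A' ** A, DFT_mat \<omega> (2 * h) (A' ** A)) (4 * F (2 * h) + 24 * real h + 16)"
proof -
  have "0 < h" using orders_pos[OF orders] by simp
  define W where "W = A' ** A"
  define Z where "Z = (\<chi> i j. map (\<lambda>m. coeff (W $ i $ j) m + coeff (W $ i $ j) (m + 2 * h)) [0..<2 * h])"
  define C where "C = (\<chi> i j. coeff (W $ i $ j) (2 * h))"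
  have degW: "degree (W $ i $ j) \<le> 2 * h" for i j
    unfolding W_def matrix_mult_2_nth
    by (intro degree_add_le order_trans[OF degree_mult_le]) (use add_mono[OF deg(2) deg(1)] in \<open>simp_all add: mult_2\<close>)
  have degW': "deg_below (2 * (2 * h)) (W $ i $ j)" for i j
    using degW[of i j] \<open>0 < h\<close> by (auto simp: deg_below_def coeff_eq_0)
  have C: "apply_arith Add (apply_arith Mul (coeff (A' $ i $ 1) h) (coeff (A $ 1 $ j) h))
      (apply_arith Mul (coeff (A' $ i $ 2) h) (coeff (A $ 2 $ j) h)) = C $ i $ j" for i j
    by (simp add: C_def W_def matrix_mult_2_nth coeff_mult_top deg)
  have N: "Poly (apply_arith Sub ((Z $ i $ j) ! 0) (C $ i $ j) # tl (Z $ i $ j) @ [C $ i $ j]) = W $ i $ j"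
    for i j
  proof (rule poly_eqI)
    fix m
    have len: "length (Z $ i $ j) = 2 * h" by (simp add: Z_def)
    \<comment> \<open>Index 0 has \<open>C\<close> subtracted, index \<open>2 * h\<close> is the
      appended \<open>C\<close>, and in between the cyclic product is exact.\<close>
    consider "m = 0" | l where "m = Suc l" "m < 2 * h" | l where "m = Suc l" "m = 2 * h" | "2 * h < m"
      by (cases m) (auto, linarith)
    then show "coeff (Poly (apply_arith Sub ((Z $ i $ j) ! 0) (C $ i $ j) # tl (Z $ i $ j) @ [C $ i $ j])) m
        = coeff (W $ i $ j) m"
    proof cases
      case 1
      then show ?thesis using \<open>0 < h\<close> by (simp add: Z_def C_def)
    next
      case 2
      moreover have "coeff (W $ i $ j) (m + 2 * h) = 0"
        using degW[of i j] 2 by (intro coeff_eq_0) simp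
      moreover have "l < 2 * h - 1" using 2 by simp
      ultimately show ?thesis using len
        by (simp add: nth_default_append nth_tl) (simp add: Z_def)
    next
      case 3
      then show ?thesis using len by (simp add: nth_default_append) (simp add: C_def)
    next
      case 4
      then have "coeff (W $ i $ j) m = 0"
        using degW[of i j] by (intro coeff_eq_0) simp
      moreover have "length (apply_arith Sub ((Z $ i $ j) ! 0) (C $ i $ j) # tl (Z $ i $ j) @ [C $ i $ j]) \<le> m"
        using len 4 \<open>0 < h\<close> by simp
      ultimately show ?thesis by (simp only: coeff_Poly_eq nth_default_beyond)
    qed
  qed
  have div: "2 * h div 2 = h" by simp
  have 1: "computes (build_mat (\<lambda>i j. run_prog (idft (2 * h)) (DFT_mat \<omega> (2 * h) W $ i $ j))) Z
      (4 * F (2 * h))"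
    using computes_idft[OF orders degW'] by (intro computes_build_mat) (simp add: Z_def)
  have 2: "computes (build_mat (\<lambda>i j. do {
       u \<leftarrow> arith_op Mul (coeff (A' $ i $ 1) h) (coeff (A $ 1 $ j) h);
       v \<leftarrow> arith_op Mul (coeff (A' $ i $ 2) h) (coeff (A $ 2 $ j) h);
       arith_op Add u v
     })) C (4 * (1 + (1 + 1)))"
    by (rule computes_build_mat, unfold C[symmetric]) (rule computes_bind computes_arith)+
  have 3: "computes (build_mat (\<lambda>i j. do {
       z0 \<leftarrow> arith_op Sub ((Z $ i $ j) ! 0) (C $ i $ j);
       return (Poly (z0 # tl (Z $ i $ j) @ [C $ i $ j]))
     })) W (4 * (1 + 0))"
    by (rule computes_build_mat, unfold N[symmetric]) (rule computes_bind computes_arith computes_return)+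
  have "computes (algorithm_F_combine idft (2 * h) A (DFT_mat \<omega> (2 * h) A) A' (DFT_mat \<omega> (2 * h) A'))
    (W, DFT_mat \<omega> (2 * h) W) (12 * real (2 * h) + (4 * F (2 * h) + (4 * (1 + (1 + 1)) + (4 * (1 + 0) + 0))))"
    unfolding algorithm_F_combine_def Let_def div
    by (rule computes_bind[OF computes_mat_mult_op[of _ "2 * h" A' A, folded W_def]]
       computes_bind[OF 1] computes_bind[OF 2] computes_bind[OF 3] computes_return)+
  then show ?thesis unfolding W_def by (rule computes_mono) simp
qed

end

section \<open>The cost recurrence\<close>

text \<open>Such a program never reaches a \<open>Compute\<close>, and nonzero inputs all take the
  same branch at every zero test, so one fixed list of operands is output.\<close>

lemma zero_cost_outputs:
  fixes p :: "'a::field prog"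
  assumes "\<And>env. length env = n \<Longrightarrow> 0 \<notin> set env \<Longrightarrow> cost (run_prog p env) = 0"
  shows "\<exists>vs. \<forall>env. length env = n \<longrightarrow> 0 \<notin> set env \<longrightarrow>
    result (run_prog p env) = map (operand_val env) vs"
  using assms
proof (induction p)
  case (Output vs)
  then show ?case by (auto simp: result_def)
next
  case (Compute f u v p)
  let ?env = "replicate n (1 :: 'a)"
  have "cost (run_prog (Compute f u v p) ?env) = 0"
    by (rule Compute.prems) (auto split: if_splits)
  moreover obtain m r where
    "\<And>c. run_state (run_prog p (?env @ [apply_arith f (operand_val ?env u) (operand_val ?env v)])) c
       = (r, c + m)"
    using computes_run_prog unfolding computes_def by blast
  ultimately have False
    by (simp add: cost_def arith_op_def State_Monad.get_def State_Monad.set_def)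
  then show ?case ..
next
  case (If_Zero v p q)
  have "\<exists>b. \<forall>env :: 'a list. length env = n \<longrightarrow> 0 \<notin> set env \<longrightarrow> (operand_val env v = 0) = b"
  proof (cases v)
    case (Var i)
    \<comment> \<open>A variable beyond the inputs reads as 0, whereas the inputs themselves are
      nonzero.\<close>
    then show ?thesis by (intro exI[of _ "\<not> i < n"]) (auto simp: in_set_conv_nth)
  next
    case (Const x)
    then show ?thesis by (intro exI[of _ "x = 0"]) simp
  qed
  then obtain b where b:
    "\<And>env :: 'a list. length env = n \<Longrightarrow> 0 \<notin> set env \<Longrightarrow> (operand_val env v = 0) = b"
    by blast
  show ?case
  proof (cases b)
    case True
    then show ?thesis using If_Zero.IH(1) If_Zero.prems b by simp
  next
    case False
    then show ?thesis using If_Zero.IH(2) If_Zero.prems b by simp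
  qed
qed

context binary_fft_model
begin

text \<open>A program without arithmetic operations computes a projection or a constant on nonzero inputs,
  but multiplication distinguishes \<open>1\<close> from \<open>- 1\<close> in both arguments.\<close>

lemma M_1_ge_1: "1 \<le> M 1"
proof (rule ccontr)
  assume "\<not> 1 \<le> M 1"
  have len2: "\<exists>x y. env = [x, y]" if "length env = 2" for env :: "'a list"
    using that by (auto simp: numeral_2_eq_2 length_Suc_conv)
  have "cost (run_prog (mult 1) env) = 0" if "length env = 2" for env
  proof -
    obtain x y where "env = [x, y]" using len2[OF \<open>length env = 2\<close>] by blast
    then have "real (cost (run_prog (mult 1) env)) \<le> M 1" using mult_cost[of "[x]" 1 "[y]"] by simp
    then show ?thesis using \<open>\<not> 1 \<le> M 1\<close> by simp
  qed
  then obtain vs where vs: "\<And>env. length env = 2 \<Longrightarrow> 0 \<notin> set env \<Longrightarrow>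
      result (run_prog (mult 1) env) = map (operand_val env) vs"
    using zero_cost_outputs[of 2 "mult 1"] by blast
  have prod: "map (operand_val [x, y]) vs = [x * y]" if "x \<noteq> 0" "y \<noteq> 0" for x y
    using mult_correct[of "[x]" 1 "[y]"] vs[of "[x, y]"] that
    by (simp add: slice_def mult.commute)
  have "(1 :: 'a) + 1 \<noteq> 0" using two_invertible by simp
  then have ne: "(1 :: 'a) \<noteq> - 1" by (simp add: eq_neg_iff_add_eq_0)
  obtain v where "vs = [v]" using prod[of 1 1] by (cases vs) auto
  with prod have v: "operand_val [x, y] v = x * y" if "x \<noteq> 0" "y \<noteq> 0" for x y
    using that by simp
  show False
    using v[of 1 1] v[of 1 "- 1"] v[of "- 1" 1] v[of "- 1" "- 1"] ne
    by (cases v) (auto simp: nth_Cons split: if_splits nat.splits)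
qed

section \<open>Growth of \<open>M\<close>\<close>

lemma M_ge:
  assumes "1 \<le> n"
  shows "real n \<le> M n"
proof -
  have "1 * real n \<le> M 1 * real n" by (intro mult_right_mono M_1_ge_1) simp
  also have "\<dots> \<le> M n" using M_mono1[of 1 n] assms by (simp add: le_divide_eq)
  finally show ?thesis by simp
qed

text \<open>Monotonicity of \<open>M m / (m * log 2 m)\<close> between consecutive powers of two,
  with denominators cleared: this makes the levels of the recursion decay linearly.\<close>

lemma M_double:
  assumes "1 \<le> n"
  shows "2 * M (2 ^ n) * real (Suc n) \<le> M (2 ^ Suc n) * real n"
proof -
  have "M (2 ^ n) / (real (2 ^ n) * log 2 (real (2 ^ n))) \<le>
      M (2 ^ Suc n) / (real (2 ^ Suc n) * log 2 (real (2 ^ Suc n)))"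
    using assms by (intro M_mono2) (auto simp: self_le_power)
  moreover have "log 2 (real (2 ^ m)) = real m" for m
    by (simp add: log_nat_power)
  ultimately have "M (2 ^ n) / (2 ^ n * real n) \<le> M (2 ^ Suc n) / (2 ^ Suc n * real (Suc n))"
    by (simp only: of_nat_power of_nat_numeral)
  moreover have pos: "0 < 2 ^ n * real n" "0 < 2 ^ Suc n * real (Suc n)" using assms by simp_all
  ultimately have "M (2 ^ n) * (2 ^ Suc n * real (Suc n)) \<le> M (2 ^ Suc n) * (2 ^ n * real n)"
    by (simp only: pos_divide_le_eq[OF pos(1)] times_divide_eq_left pos_le_divide_eq[OF pos(2)])
  then have "2 ^ n * (2 * M (2 ^ n) * real (Suc n)) \<le> 2 ^ n * (M (2 ^ Suc n) * real n)"
    by (simp add: mult_ac del: of_nat_Suc)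
  then show ?thesis by (simp del: of_nat_Suc)
qed

text \<open>The same monotonicity, starting from order 2, where \<open>M 2 \<ge> 2\<close>. It
  absorbs the linear work summed over all levels.\<close>

lemma n_log_n_le_M: "2 ^ n * real n \<le> 2 * M (2 ^ n)"
proof (cases "n = 0")
  case True
  then show ?thesis using M_1_ge_1 by simp
next
  case False
  have "M 2 / (real 2 * log 2 (real 2)) \<le> M (2 ^ n) / (real (2 ^ n) * log 2 (real (2 ^ n)))"
    using False by (intro M_mono2) (auto simp: self_le_power)
  moreover have "1 \<le> M 2 / 2" using M_ge[of 2] by simp
  ultimately have "1 / 2 \<le> M (2 ^ n) / (2 ^ n * real n)"
    by (simp add: log_nat_power)
  then show ?thesis using False by (simp add: field_simps)
qed

text \<open>The twelve large transforms are eight in the update and four in the combination; the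
  eight small ones come from two doublings. With \<open>h = 2 ^ n\<close>, the remaining work is
  \<open>2 * (8 * h + 8)\<close>, \<open>28 * h + 4\<close> and \<open>24 * h + 16\<close>.\<close>

primrec cost_bound :: "nat \<Rightarrow> real" where
  "cost_bound 0 = 7"
| "cost_bound (Suc n) =
    2 * cost_bound n + 12 * F (2 ^ Suc n) + 8 * F (2 ^ n) + 34 * 2 ^ Suc n + 36"

lemma computes_algorithm_F:
  assumes "2 ^ n \<in> orders" "normal_rem_seq P Q (2 ^ n)"
  shows "computes (algorithm_F \<omega> dft idft P Q (2 ^ n))
    (Bprod P Q 1 (Suc (2 ^ n)), DFT_mat \<omega> (2 ^ n) (Bprod P Q 1 (Suc (2 ^ n)))) (cost_bound n)"
  using assms
proof (induction n arbitrary: P Q)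
  case 0
  then show ?case using computes_algorithm_F_base[of P Q] by (simp add: algorithm_F.simps)
next
  case (Suc n)
  define h :: nat where "h = 2 ^ n"
  have k: "2 ^ Suc n = 2 * h" by (simp add: h_def)
  have "0 < h" by (simp add: h_def)
  have orders: "2 * h \<in> orders" and normal: "normal_rem_seq P Q (2 * h)"
    using Suc.prems unfolding k by auto
  have orders_h: "h \<in> orders" using orders_dvd[OF orders, of h] by simp
  let ?d = "degree P" and ?R = "rem_seq P Q"
  define A where "A = Bprod P Q 1 (Suc h)"
  define A' where "A' = Bprod (?R h) (?R (Suc h)) 1 (Suc h)"
  have normal1: "normal_rem_seq P Q h" by (rule normal_rem_seq_le[OF normal]) simp
  have normal2: "normal_rem_seq (?R h) (?R (Suc h)) h"
    using normal by (intro normal_rem_seq_shift) (simp add: mult_2)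
  have "degree (?R h) + h = ?d" using normal1 by (simp add: normal_rem_seq_def)
  \<comment> \<open>The second call needs its input cut at this index, which is where the update
    delivers it.\<close>
  then have e: "degree (?R h) - 2 * h = ?d - 3 * h" by simp
  note IH = Suc.IH[folded h_def, OF orders_h]
  have 1: "computes (algorithm_F \<omega> dft idft (tail P (?d - 2 * h)) (tail Q (?d - 2 * h)) h)
      (A, DFT_mat \<omega> h A) (cost_bound n)"
    using IH[OF normal_rem_seq_tail[OF normal1]] unfolding Bprod_tail[OF normal1] A_def .
  have 2: "computes (algorithm_F \<omega> dft idft (tail (?R h) (?d - 3 * h)) (tail (?R (Suc h)) (?d - 3 * h)) h)
      (A', DFT_mat \<omega> h A') (cost_bound n)"
    using IH[OF normal_rem_seq_tail[OF normal2]] unfolding e Bprod_tail[OF normal2, unfolded e] A'_def .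
  have deg: "degree (A $ i $ j) \<le> h" "degree (A' $ i $ j) \<le> h" for i j
    unfolding A_def A'_def by (rule degree_Bprod normal1 normal2)+
  have 3: "computes (build_mat (\<lambda>i j. fft_double \<omega> dft (2 * h) (B $ i $ j) (DFT_mat \<omega> h B $ i $ j)))
      (DFT_mat \<omega> (2 * h) B) (4 * (F h + 2 * real h + 2))"
    if "\<And>i j. degree (B $ i $ j) \<le> h" for B
    using that computes_fft_double[OF orders] by (intro computes_build_mat) simp
  have div: "2 * h div 2 = h" and "(2 * h \<le> 1) = False" using \<open>0 < h\<close> by auto
  have main: "computes (algorithm_F \<omega> dft idft P Q (2 * h))
      (A' ** A, DFT_mat \<omega> (2 * h) (A' ** A))
      (cost_bound n + (4 * (F h + 2 * real h + 2) + ((8 * F (2 * h) + 28 * real h + 4) +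
       (cost_bound n + (4 * (F h + 2 * real h + 2) + (4 * F (2 * h) + 24 * real h + 16))))))"
    unfolding algorithm_F.simps[of _ _ _ _ _ "2 * h"] Let_def div \<open>(2 * h \<le> 1) = False\<close> if_False
    by (rule computes_case_prod computes_bind[OF 1] computes_bind[OF 2] computes_bind[OF 3[OF deg(1)]]
      computes_bind[OF 3[OF deg(2)]] computes_bind[OF computes_algorithm_F_update[OF orders normal, folded A_def]]
      computes_algorithm_F_combine[OF orders deg])+
  have prod: "A' ** A = Bprod P Q 1 (Suc (2 * h))"
    using Bprod_shift[of P Q h h] by (simp only: A_def A'_def mult_2)
  show ?case
    unfolding k using main unfolding prod by (rule computes_mono) (simp add: h_def)
qed

text \<open>In the induction \<open>M_double\<close> turns the doubled main term into
  \<open>4 / 3 * M (2 ^ Suc n) * n\<close>; the level adds \<open>8 / 3 * M (2 ^ Suc n)\<close>,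
  which advances the factor to \<open>n + 2\<close>.\<close>

lemma cost_bound_le:
  "\<exists>c. \<forall>n. 2 ^ n \<in> orders \<longrightarrow>
    cost_bound n \<le> 4 / 3 * M (2 ^ n) * (real n + 1) + c * 2 ^ n * real n + 7 * 2 ^ n"
proof -
  obtain c where "\<And>n. n \<in> orders \<Longrightarrow> \<bar>M n - 6 * F n\<bar> \<le> c * real n"
    using M_F by blast
  then have F: "6 * F n \<le> M n + c * real n" if "n \<in> orders" for n
    using that by (fastforce simp: abs_le_iff)
  \<comment> \<open>Sixteen transforms contribute \<open>8 / 3 * c\<close>; the rest is 34 plus 18,
    as \<open>36 \<le> 18 * 2 ^ Suc n\<close>.\<close>
  define b where "b = 8 / 3 * c + 52"
  have "cost_bound n \<le> 4 / 3 * M (2 ^ n) * (real n + 1) + b * 2 ^ n * real n + 7 * 2 ^ n"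
    if "2 ^ n \<in> orders" for n
    using that
  proof (induction n)
    case 0
    then show ?case using M_1_ge_1 by simp
  next
    case (Suc n)
    have n: "2 ^ n \<in> orders" by (rule orders_dvd[OF Suc.prems]) simp
    have "F (2 ^ n) / real (2 ^ n) \<le> F (2 ^ Suc n) / real (2 ^ Suc n)"
      by (rule F_mono1[OF n Suc.prems]) simp_all
    then have half: "2 * F (2 ^ n) \<le> F (2 ^ Suc n)" by (simp add: field_simps)
    define p :: real where "p = 2 ^ n"
    have "1 \<le> p" by (simp add: p_def)
    then have "12 * F (2 ^ Suc n) + 8 * F (2 ^ n) + 34 * 2 ^ Suc n + 36
        \<le> 8 / 3 * M (2 ^ Suc n) + b * 2 ^ Suc n"
      using half F[OF Suc.prems] unfolding b_def by (simp add: algebra_simps flip: p_def)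
    moreover have "2 * cost_bound n \<le>
        4 / 3 * (2 * M (2 ^ n) * real (Suc n)) + b * 2 ^ Suc n * real n + 7 * 2 ^ Suc n"
      using mult_left_mono[OF Suc.IH[OF n], of 2] by (simp add: field_simps)
    ultimately have *: "cost_bound (Suc n) \<le> 4 / 3 * (2 * M (2 ^ n) * real (Suc n)) + 8 / 3 * M (2 ^ Suc n)
        + b * 2 ^ Suc n * real (Suc n) + 7 * 2 ^ Suc n"
      by (simp add: algebra_simps)
    show ?case
    proof (cases "n = 0")
      case True
      then have "cost_bound (Suc n) \<le> 14 + (8 / 3 * M 2 + b * 2)"
        using \<open>12 * F (2 ^ Suc n) + _ + _ + _ \<le> _\<close> by simp
      then show ?thesis using True by simp
    next
      case False
      then have "2 * M (2 ^ n) * real (Suc n) \<le> M (2 ^ Suc n) * real n"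
        by (intro M_double) simp
      moreover have "4 / 3 * M (2 ^ Suc n) * (real (Suc n) + 1) =
          4 / 3 * (M (2 ^ Suc n) * real n) + 8 / 3 * M (2 ^ Suc n)"
        by (simp add: algebra_simps)
      ultimately show ?thesis using * by linarith
    qed
  qed
  then show ?thesis by blast
qed

end

theorem proposition7:
  fixes orders :: "nat set"
    and \<omega> :: "nat \<Rightarrow> 'a::field"
    and dft idft mult :: "nat \<Rightarrow> 'a prog"
    and F M :: "nat \<Rightarrow> real"
  assumes "binary_fft_model orders \<omega> dft idft mult F M"
  shows "(\<forall>P Q k. k \<in> orders \<and> valid_input P Q k \<longrightarrow>
            result (algorithm_F \<omega> dft idft P Q k) =
              (Bprod P Q 1 (k + 1), DFT_mat \<omega> k (Bprod P Q 1 (k + 1)))) \<and>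
         (\<exists>C. \<forall>P Q k. k \<in> orders \<and> valid_input P Q k \<longrightarrow>
            real (cost (algorithm_F \<omega> dft idft P Q k)) \<le>
              4 / 3 * M k * log 2 (real k) + C * M k)"
proof -
  interpret binary_fft_model orders \<omega> dft idft mult F M by fact
  obtain c where c: "\<And>n. 2 ^ n \<in> orders \<Longrightarrow>
      cost_bound n \<le> 4 / 3 * M (2 ^ n) * (real n + 1) + c * 2 ^ n * real n + 7 * 2 ^ n"
    using cost_bound_le by blast
  have computes: "\<exists>n. k = 2 ^ n \<and> computes (algorithm_F \<omega> dft idft P Q k)
      (Bprod P Q 1 (k + 1), DFT_mat \<omega> k (Bprod P Q 1 (k + 1))) (cost_bound n)"
    if k: "k \<in> orders" and valid: "valid_input P Q k" for P Q k
  proof -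
    obtain n where "k = 2 ^ n" using orders_power_of_two[OF k] by blast
    with computes_algorithm_F[of n P Q] k valid_input_normal_rem_seq[OF valid]
    show ?thesis by (metis Suc_eq_plus1)
  qed
  \<comment> \<open>The constant collects \<open>4 / 3\<close> from \<open>n + 1\<close> against
    \<open>n\<close>, \<open>2 * \<bar>c\<bar>\<close> from \<open>n_log_n_le_M\<close>, and 7 from
    \<open>2 ^ n \<le> M (2 ^ n)\<close>. The sign of \<open>c\<close> is unknown, hence the
    absolute value.\<close>
  have bound: "cost_bound n \<le> 4 / 3 * M (2 ^ n) * log 2 (real (2 ^ n)) + (4 / 3 + 2 * \<bar>c\<bar> + 7) * M (2 ^ n)"
    if "2 ^ n \<in> orders" for n
  proof -
    have "c * (2 ^ n * real n) \<le> \<bar>c\<bar> * (2 ^ n * real n)"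
      by (intro mult_right_mono) auto
    also have "\<dots> \<le> \<bar>c\<bar> * (2 * M (2 ^ n))"
      by (intro mult_left_mono n_log_n_le_M) simp
    finally have "c * 2 ^ n * real n \<le> 2 * \<bar>c\<bar> * M (2 ^ n)" by (simp add: mult_ac)
    moreover have "2 ^ n \<le> M (2 ^ n)" using M_ge[of "2 ^ n"] by simp
    moreover have log: "log 2 (real (2 ^ n)) = real n" by (simp add: log_nat_power)
    moreover have "4 / 3 * M (2 ^ n) * (real n + 1) = 4 / 3 * M (2 ^ n) * real n + 4 / 3 * M (2 ^ n)"
      "(4 / 3 + 2 * \<bar>c\<bar> + 7) * M (2 ^ n) = 4 / 3 * M (2 ^ n) + 2 * \<bar>c\<bar> * M (2 ^ n) + 7 * M (2 ^ n)"
      by (simp_all only: distrib_left distrib_right mult_1_right)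
    ultimately show ?thesis unfolding log using c[OF that] by linarith
  qed
  show ?thesis
  proof (intro conjI exI[of _ "4 / 3 + 2 * \<bar>c\<bar> + 7"] allI impI; elim conjE)
    fix P Q :: "'a poly" and k assume "k \<in> orders" "valid_input P Q k"
    from computes[OF this]
    show "result (algorithm_F \<omega> dft idft P Q k) =
        (Bprod P Q 1 (k + 1), DFT_mat \<omega> k (Bprod P Q 1 (k + 1)))"
      by (auto dest: computes_result)
  next
    fix P Q :: "'a poly" and k assume k: "k \<in> orders" and valid: "valid_input P Q k"
    obtain n where n: "k = 2 ^ n" and "real (cost (algorithm_F \<omega> dft idft P Q k)) \<le> cost_bound n"
      using computes[OF k valid] by (auto dest: computes_cost)
    moreover have "cost_bound n \<le> 4 / 3 * M k * log 2 (real k) + (4 / 3 + 2 * \<bar>c\<bar> + 7) * M k"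
      using bound[of n] k unfolding n by simp
    ultimately show "real (cost (algorithm_F \<omega> dft idft P Q k)) \<le>
        4 / 3 * M k * log 2 (real k) + (4 / 3 + 2 * \<bar>c\<bar> + 7) * M k"
      by linarith
  qed
qed

end
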